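(* For every real $k\in\left(\frac{\sqrt{41}-5}{8},1\right)$, $$\sum_{n=0}^\infty \binom{2n}{n}^2 P_n\!\left(\frac{1-3k+2k^2-2k^3}{4k^2-3k+1}\right)\left(\frac{-(1+k)(4k^2-3k+1)}{64k}\right)^n\bigl(C_3n^3+C_2n^2+C_1n+C_0\bigr)=\frac{8k^{3/2}(4k^2-3k+1)}{\pi},$$ where $$C_3=\frac{4(k-1)^2}{k+1}(2k-1)(4k^2+3k+1)^2,$$ $$C_2=12(k-1)(2k-1)(16k^4+k^2-1),$$ $$C_1=288k^6-400k^5+102k^4+97k^3-93k^2+47k-9,$$ $$C_0=2(32k^6-44k^5+9k^4+16k^3-14k^2+6k-1).$$
   Context: $P_n$ denotes the $n$-th Legendre polynomial, $P_n(x)={}_2F_1\bigl(-n,n+1;1;\tfrac{1-x}{2}\bigr)$. *)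

theory Defs
  imports "HOL-Analysis.Analysis"
begin

definition hyp2F1 :: "real \<Rightarrow> real \<Rightarrow> real \<Rightarrow> real \<Rightarrow> real" where
  "hyp2F1 a b c z = eval_fps (fps_hypergeo [a, b] [c] 1) z"

text \<open>
  The third parameter of \<^const>\<open>fps_hypergeo\<close> scales the argument, so the value 1 gives the
  usual Gauss series. \<^const>\<open>eval_fps\<close> sums it.
\<close>

lemma hyp2F1_eq_suminf:
  "hyp2F1 a b c z =
     (\<Sum>m. pochhammer a m * pochhammer b m / (pochhammer c m * fact m) * z ^ m)"
  by (simp add: hyp2F1_def eval_fps_def)

definition legendre_P :: "nat \<Rightarrow> real \<Rightarrow> real" where
  "legendre_P n x = hyp2F1 (- real n) (real n + 1) 1 ((1 - x) / 2)"

text \<open>The series terminates, so \<^const>\<open>legendre_P\<close> is meaningful for every real argument.\<close>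

lemma legendre_P_eq_sum:
  "legendre_P n x =
     (\<Sum>m\<le>n. pochhammer (- real n) m * pochhammer (real n + 1) m / (fact m)\<^sup>2
               * ((1 - x) / 2) ^ m)"
  unfolding legendre_P_def hyp2F1_eq_suminf
  by (subst suminf_finite[of "{..n}"])
     (auto simp: pochhammer_of_nat_eq_0_iff pochhammer_fact[symmetric] power2_eq_square)

definition C3 :: "real \<Rightarrow> real" where
  "C3 k = 4 * (k - 1)\<^sup>2 / (k + 1) * (2 * k - 1) * (4 * k\<^sup>2 + 3 * k + 1)\<^sup>2"

definition C2 :: "real \<Rightarrow> real" where
  "C2 k = 12 * (k - 1) * (2 * k - 1) * (16 * k ^ 4 + k\<^sup>2 - 1)"

definition C1 :: "real \<Rightarrow> real" where
  "C1 k = 288 * k ^ 6 - 400 * k ^ 5 + 102 * k ^ 4 + 97 * k ^ 3 - 93 * k\<^sup>2 + 47 * k - 9"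

definition C0 :: "real \<Rightarrow> real" where
  "C0 k = 2 * (32 * k ^ 6 - 44 * k ^ 5 + 9 * k ^ 4 + 16 * k ^ 3 - 14 * k\<^sup>2 + 6 * k - 1)"

end

theory Submission
  imports Defs "HOL-Complex_Analysis.Complex_Analysis" "HOL-Real_Asymp.Real_Asymp"
begin

text \<open>
  Write \<open>F(z) = 2F1(1/2, 1/2; 1; z) = (2/pi) K(sqrt z)\<close> and \<open>\<rho> = sqrt (1 - 2xz + z\<^sup>2)\<close>. Brafman's formula
  factorises the generating function of \<open>binom(2n,n)\<^sup>2 P\<^sub>n(x) (z/16)\<^sup>n\<close> as \<open>F(\<alpha>) F(\<beta>)\<close> with
  \<open>\<alpha> = (1 - \<rho> - z)/2\<close>, \<open>\<beta> = (1 - \<rho> + z)/2\<close>. It is proved by noting that the product is holomorphic on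
  the unit disc and that its Taylor coefficients obey the three-term recurrence of the left-hand side.
  For \<open>z = - (1 + k)(4k\<^sup>2 - 3k + 1)/(4k)\<close> and the given \<open>x\<close> one finds \<open>\<alpha> = k\<^sup>2\<close> and \<open>\<beta> = - (1 - k)\<^sup>2/(4k)\<close>, and
  a quadratic transformation gives \<open>F(\<beta>) = sqrt k F(1 - k\<^sup>2)\<close>. Applying \<open>C\<^sub>3 \<theta>\<^sup>3 + C\<^sub>2 \<theta>\<^sup>2 + C\<^sub>1 \<theta> + C\<^sub>0\<close> with
  \<open>\<theta> = z d/dz\<close> leaves exactly the bilinear combination of \<open>F\<close>, \<open>F'\<close> at \<open>k\<^sup>2\<close> and \<open>1 - k\<^sup>2\<close> that Legendre's
  relation evaluates to \<open>1/pi\<close>.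
\<close>

section \<open>The complete elliptic integral as a power series\<close>

text \<open>
  The series \<open>ell z\<close> is the hypergeometric function 2F1(1/2, 1/2; 1; z) = (2/pi) K(sqrt z).
\<close>

definition ell_coeff :: "nat \<Rightarrow> real" where
  "ell_coeff n = (real ((2 * n) choose n) / 4 ^ n)\<^sup>2"

definition ell_fps :: "'a :: {banach, real_normed_field} fps" where
  "ell_fps = Abs_fps (\<lambda>n. of_real (ell_coeff n))"

abbreviation ell :: "'a :: {banach, real_normed_field} \<Rightarrow> 'a" where
  "ell \<equiv> eval_fps ell_fps"

abbreviation dell :: "'a :: {banach, real_normed_field} \<Rightarrow> 'a" where
  "dell \<equiv> eval_fps (fps_deriv ell_fps)"

section \<open>Coefficients: ratio, bounds and asymptotics\<close>

lemma ell_coeff_0 [simp]: "ell_coeff 0 = 1"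
  by (simp add: ell_coeff_def)

lemma ell_coeff_pos: "ell_coeff n > 0"
  by (simp add: ell_coeff_def)

lemma ell_coeff_Suc:
  "ell_coeff (Suc n) = ((2 * real n + 1) / (2 * real n + 2))\<^sup>2 * ell_coeff n"
proof -
  have *: "real ((2 * m) choose m) = fact (2 * m) / (fact m * fact m)" for m
    by (subst binomial_fact) (auto simp: mult_2)
  have "real ((2 * Suc n) choose Suc n) / 4 ^ Suc n =
        (2 * real n + 1) / (2 * real n + 2) * (real ((2 * n) choose n) / 4 ^ n)"
    unfolding * by (simp add: divide_simps) (simp add: algebra_simps)
  then show ?thesis
    unfolding ell_coeff_def by (simp only: power_mult_distrib)
qed

lemma ell_coeff_le_1: "ell_coeff n \<le> 1"
proof (induction n)
  case (Suc n)
  have "((2 * real n + 1) / (2 * real n + 2))\<^sup>2 \<le> 1"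
    by (intro power_le_one) auto
  then show ?case
    using Suc ell_coeff_pos[of n] mult_mono[of "((2 * real n + 1) / (2 * real n + 2))\<^sup>2" 1 "ell_coeff n" 1]
    by (simp add: ell_coeff_Suc)
qed simp

lemma ell_coeff_rec:
  "(real n + 1)\<^sup>2 * ell_coeff (Suc n) = (real n + 1/2)\<^sup>2 * ell_coeff n"
proof -
  have "(real n + 1)\<^sup>2 * ((2 * real n + 1) / (2 * real n + 2))\<^sup>2 = ((real n + 1) * ((2 * real n + 1) / (2 * real n + 2)))\<^sup>2"
    by (rule power_mult_distrib[symmetric])
  also have "(real n + 1) * ((2 * real n + 1) / (2 * real n + 2)) = real n + 1/2"
    by (simp add: field_simps)
  finally show ?thesis by (simp add: ell_coeff_Suc)
qed

text \<open>The expression is the reciprocal of the n-th partial product in Wallis' formula. Every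
  later occurrence of pi descends from this limit.\<close>

lemma ell_coeff_asymptotics: "(\<lambda>n. (2 * real n + 1) * ell_coeff n) \<longlonglongrightarrow> 2 / pi"
proof -
  have *: "(2 * real n + 1) * ell_coeff n = inverse (\<Prod>k=1..n. (4 * real k ^ 2) / (4 * real k ^ 2 - 1))" for n
  proof (induction n)
    case (Suc n)
    have "(2 * real (Suc n) + 1) * ell_coeff (Suc n) =
      (4 * real (Suc n) ^ 2 - 1) / (4 * real (Suc n) ^ 2) * ((2 * real n + 1) * ell_coeff n)"
      by (simp add: ell_coeff_Suc divide_simps power2_eq_square) (simp add: algebra_simps)
    then show ?case unfolding Suc by (simp add: field_simps)
  qed simp
  have "(\<lambda>n. inverse (\<Prod>k=1..n. (4 * real k ^ 2) / (4 * real k ^ 2 - 1))) \<longlonglongrightarrow> inverse (pi / 2)"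
    by (intro tendsto_inverse wallis) simp
  then show ?thesis unfolding * by simp
qed

lemma ell_coeff_tendsto_0: "ell_coeff \<longlonglongrightarrow> 0"
proof -
  have "(\<lambda>n. inverse (2 * real n + 1) * ((2 * real n + 1) * ell_coeff n)) \<longlonglongrightarrow> 0 * (2 / pi)"
    by (intro tendsto_mult ell_coeff_asymptotics) real_asymp
  also have "(\<lambda>n. inverse (2 * real n + 1) * ((2 * real n + 1) * ell_coeff n)) = ell_coeff"
  proof
    fix n show "inverse (2 * real n + 1) * ((2 * real n + 1) * ell_coeff n) = ell_coeff n"
      using add_pos_nonneg[of 1 "2 * real n"] by (simp add: field_simps)
  qed
  finally show ?thesis by simp
qed

text \<open>These are the coefficients of \<open>dell\<close>; their limit fixes how fast
  \<open>dell\<close> blows up at 1. The factor n + 1 is written as half of (2(n + 1) + 1) - 1, so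
  the two previous limits apply.\<close>

lemma Suc_ell_coeff_tendsto: "(\<lambda>n. (real n + 1) * ell_coeff (Suc n)) \<longlonglongrightarrow> 1 / pi"
proof -
  have "(\<lambda>n. (1/2) * ((2 * real (Suc n) + 1) * ell_coeff (Suc n)) - (1/2) * ell_coeff (Suc n)) \<longlonglongrightarrow> (1/2) * (2/pi) - (1/2) * 0"
    by (intro tendsto_diff tendsto_mult tendsto_const LIMSEQ_Suc[OF ell_coeff_asymptotics]
          LIMSEQ_Suc[OF ell_coeff_tendsto_0])
  then show ?thesis by (simp add: algebra_simps add_divide_distrib)
qed

section \<open>Convergence in the unit disc and the differential equation\<close>

lemma conv_radius_ell: "fps_conv_radius (ell_fps :: 'a :: {banach, real_normed_field} fps) \<ge> 1"
  unfolding fps_conv_radius_def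
proof (rule conv_radius_geI_ex)
  fix r :: real assume r: "0 < r" "ereal r < 1"
  have "summable (\<lambda>n. fps_nth (ell_fps :: 'a fps) n * of_real r ^ n)"
  proof (rule summable_comparison_test)
    show "summable (\<lambda>n. r ^ n)" using r by (intro summable_geometric) auto
    show "\<exists>N. \<forall>n\<ge>N. norm (fps_nth (ell_fps :: 'a fps) n * of_real r ^ n) \<le> r ^ n"
      using r ell_coeff_le_1 by (auto simp: ell_fps_def norm_mult norm_power abs_of_pos[OF ell_coeff_pos] intro!: mult_left_le_one_le less_imp_le[OF ell_coeff_pos])
  qed
  then show "\<exists>z::'a. norm z = r \<and> summable (\<lambda>n. fps_nth ell_fps n * z ^ n)"
    using r by (intro exI[of _ "of_real r"]) auto
qed

lemma conv_radius_dell: "fps_conv_radius (fps_deriv (ell_fps :: 'a :: {banach, real_normed_field} fps)) \<ge> 1"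
  using conv_radius_ell fps_conv_radius_deriv order_trans by blast

lemma ell_conv: "norm z < 1 \<Longrightarrow> ereal (norm z) < fps_conv_radius (ell_fps :: 'a :: {banach, real_normed_field} fps)"
  using conv_radius_ell[where 'a='a] by (metis ereal_less(3) less_le_trans)

lemma dell_conv: "norm z < 1 \<Longrightarrow> ereal (norm z) < fps_conv_radius (fps_deriv (ell_fps :: 'a :: {banach, real_normed_field} fps))"
  using conv_radius_dell[where 'a='a] by (metis ereal_less(3) less_le_trans)

lemma has_field_derivative_ell:
  fixes z :: "'a :: {banach, real_normed_field}"
  shows "norm z < 1 \<Longrightarrow> (ell has_field_derivative dell z) (at z within A)"
  by (intro has_field_derivative_eval_fps ell_conv)

text \<open>This is the hypergeometric equation in self-adjoint form. Comparing coefficients turns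
  it into \<open>ell_coeff_rec\<close>, because (n + 1/2)^2 = n(n + 1) + 1/4.\<close>

lemma ell_fps_ode:
  "fps_deriv (fps_X * (1 - fps_X) * fps_deriv ell_fps) = fps_const (1/4) * (ell_fps :: 'a :: {banach, real_normed_field} fps)"
proof (rule fps_ext)
  fix n :: nat
  have *: "(real n + 1) * ((real n + 1) * ell_coeff (Suc n) - real n * ell_coeff n) = ell_coeff n / 4"
    using ell_coeff_rec[of n] by (simp add: power2_eq_square field_simps)
  have "fps_nth (fps_deriv (fps_X * (1 - fps_X) * fps_deriv ell_fps)) n =
      (of_nat (Suc n) * (of_nat (Suc n) * of_real (ell_coeff (Suc n)) - of_nat n * of_real (ell_coeff n)) :: 'a)"
    by (cases n) (simp_all add: ell_fps_def algebra_simps)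
  also have "\<dots> = of_real ((real n + 1) * ((real n + 1) * ell_coeff (Suc n) - real n * ell_coeff n))"
    by (simp add: algebra_simps)
  also have "\<dots> = fps_nth (fps_const (1/4) * ell_fps) n"
    unfolding * by (simp add: ell_fps_def)
  finally show "fps_nth (fps_deriv (fps_X * (1 - fps_X) * fps_deriv ell_fps)) n = fps_nth (fps_const (1/4) * (ell_fps :: 'a fps)) n" .
qed

text \<open>Keeping w(1 - w) \<open>dell\<close> w together as one function avoids second
  derivatives: \<open>ell\<close> and this function form a closed first-order system.\<close>

lemma ell_ode:
  fixes z :: "'a :: {banach, real_normed_field}"
  assumes "norm z < 1"
  shows "((\<lambda>w. w * (1 - w) * dell w) has_field_derivative ell z / 4) (at z within A)"
proof -
  let ?G = "fps_X * (1 - fps_X) * fps_deriv (ell_fps :: 'a fps)"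
  have r: "fps_conv_radius (fps_X * (1 - fps_X) :: 'a fps) = \<infinity>"
    using fps_conv_radius_mult[of "fps_X :: 'a fps" "1 - fps_X"] fps_conv_radius_diff[of "1 :: 'a fps" fps_X]
    by simp
  have r1: "fps_conv_radius (1 - fps_X :: 'a fps) = \<infinity>"
    using fps_conv_radius_diff[of "1 :: 'a fps" fps_X] by simp
  have "fps_conv_radius ?G \<ge> 1"
    using fps_conv_radius_mult[of "fps_X * (1 - fps_X) :: 'a fps" "fps_deriv ell_fps"] conv_radius_dell[where 'a='a] r
    by (metis min_top top_ereal_def order_trans)
  then have c: "ereal (norm z) < fps_conv_radius ?G"
    using assms by (metis ereal_less(3) less_le_trans)
  have ev: "eval_fps ?G w = w * (1 - w) * dell w" if "norm w < 1" for w :: 'a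
    using r r1 dell_conv[OF that] by (subst eval_fps_mult, simp, simp)+ (simp add: eval_fps_diff)
  have "(eval_fps ?G has_field_derivative eval_fps (fps_deriv ?G) z) (at z)"
    by (intro has_field_derivative_eval_fps c)
  also have "eval_fps (fps_deriv ?G) z = ell z / 4"
    using ell_conv[OF assms] by (simp only: ell_fps_ode, subst eval_fps_mult) auto
  finally have "((\<lambda>w. w * (1 - w) * dell w) has_field_derivative ell z / 4) (at z)"
    by (rule has_field_derivative_transform_within_open[of _ _ _ "ball 0 1"]) (use assms ev in auto)
  then show ?thesis by (rule has_field_derivative_at_within)
qed

lemma has_field_derivative_ell_compose:
  fixes u :: "'a :: {banach, real_normed_field} \<Rightarrow> 'a"
  assumes "(u has_field_derivative u') (at x within S)" "norm (u x) < 1"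
  shows "((\<lambda>x. ell (u x)) has_field_derivative dell (u x) * u') (at x within S)"
  using DERIV_chain2[where f = ell and g = u] has_field_derivative_ell assms by blast

lemma ell_ode_compose:
  fixes u :: "'a :: {banach, real_normed_field} \<Rightarrow> 'a"
  assumes "(u has_field_derivative u') (at x within S)" "norm (u x) < 1"
  shows "((\<lambda>x. u x * (1 - u x) * dell (u x)) has_field_derivative ell (u x) / 4 * u') (at x within S)"
  using DERIV_chain2[where f = "\<lambda>w. w * (1 - w) * dell w" and g = u] ell_ode assms by blast

text \<open>Brafman's formula is proved over the complex numbers, Legendre's relation over the
  reals; this and \<open>dell_of_real\<close> connect the two.\<close>

lemma ell_of_real: "norm (t :: real) < 1 \<Longrightarrow> (ell (of_real t) :: 'a :: {banach, real_normed_field}) = of_real (ell t)"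
proof -
  assume t: "norm t < 1"
  have "(\<lambda>n. fps_nth ell_fps n * t ^ n) sums ell t"
    by (intro sums_eval_fps ell_conv t)
  from sums_of_real[OF this, where 'a='a]
  have "(\<lambda>n. fps_nth (ell_fps :: 'a fps) n * of_real t ^ n) sums of_real (ell t)"
    by (simp add: ell_fps_def)
  then show ?thesis by (simp add: eval_fps_def sums_iff)
qed

lemma dell_of_real: "norm (t :: real) < 1 \<Longrightarrow> (dell (of_real t) :: 'a :: {banach, real_normed_field}) = of_real (dell t)"
proof -
  assume t: "norm t < 1"
  have "(\<lambda>n. fps_nth (fps_deriv ell_fps) n * t ^ n) sums dell t"
    by (intro sums_eval_fps dell_conv t)
  from sums_of_real[OF this, where 'a='a]
  have "(\<lambda>n. fps_nth (fps_deriv (ell_fps :: 'a fps)) n * of_real t ^ n) sums of_real (dell t)"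
    by (simp add: ell_fps_def)
  then show ?thesis by (simp add: eval_fps_def sums_iff)
qed

lemma ell_0 [simp]: "ell 0 = 1"
  by (simp add: eval_fps_at_0 ell_fps_def)

lemma dell_0 [simp]: "dell (0 :: real) = 1 / 4"
  by (simp add: eval_fps_at_0 ell_fps_def ell_coeff_Suc power2_eq_square)

lemma ell_pos:
  fixes t :: real
  assumes "0 \<le> t" "t < 1"
  shows "ell t > 0"
proof -
  have s: "(\<lambda>n. ell_coeff n * t ^ n) sums ell t"
    using sums_eval_fps[OF ell_conv, of t] assms by (simp add: ell_fps_def)
  then have "0 < (\<Sum>n. ell_coeff n * t ^ n)"
    using assms by (intro suminf_pos2[of _ 0]) (auto simp: sums_iff intro!: mult_nonneg_nonneg less_imp_le[OF ell_coeff_pos])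
  then show ?thesis using s by (simp add: sums_iff)
qed

section \<open>Boundary behaviour at 1 and Legendre's relation\<close>

text \<open>Subtracting L times the geometric series leaves coefficients b n - L. Finitely many of
  them contribute at most a constant \<open>K\<close>, which the factor 1 - t sends to 0; the others
  are below e/2 and contribute at most e/2 after that multiplication.\<close>

lemma abelian_limit:
  fixes b :: "nat \<Rightarrow> real" and g :: "real \<Rightarrow> real"
  assumes b: "b \<longlonglongrightarrow> L"
    and g: "\<And>t. 0 < t \<Longrightarrow> t < 1 \<Longrightarrow> (\<lambda>n. b n * t ^ n) sums g t"
  shows "((\<lambda>t. (1 - t) * g t) \<longlongrightarrow> L) (at_left 1)"
proof (rule tendstoI)
  fix e :: real assume e: "e > 0"
  obtain N where N: "\<And>n. n \<ge> N \<Longrightarrow> \<bar>b n - L\<bar> < e / 2"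
    using b e unfolding LIMSEQ_iff real_norm_def by (meson half_gt_zero)
  define K where "K = (\<Sum>n<N. \<bar>b n - L\<bar>)"
  have K: "K \<ge> 0" unfolding K_def by (intro sum_nonneg) auto
  have *: "\<bar>(1 - t) * g t - L\<bar> \<le> (1 - t) * K + e / 2" if t: "0 < t" "t < 1" for t
  proof -
    have geo: "(\<lambda>n. t ^ n) sums (1 / (1 - t))"
      using t by (intro geometric_sums) auto
    have s: "(\<lambda>n. (b n - L) * t ^ n) sums (g t - L * (1 / (1 - t)))"
      unfolding left_diff_distrib by (intro sums_diff g t sums_mult geo)
    define c where "c n = (if n < N then \<bar>b n - L\<bar> else 0) + e / 2 * t ^ n" for n
    have c: "c sums (K + e / 2 * (1 / (1 - t)))"
      unfolding c_def K_def
      using sums_If_finite_set[of "{..<N}" "\<lambda>n. \<bar>b n - L\<bar>"] by (intro sums_add sums_mult geo) auto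
    have le: "norm ((b n - L) * t ^ n) \<le> c n" for n
    proof (cases "n < N")
      case True
      have "\<bar>b n - L\<bar> * t ^ n \<le> \<bar>b n - L\<bar> * 1"
        using t by (intro mult_left_mono power_le_one) auto
      then show ?thesis using True t e by (simp add: c_def abs_mult add_increasing2)
    next
      case False
      then have "\<bar>b n - L\<bar> * t ^ n \<le> e / 2 * t ^ n"
        using N[of n] t by (intro mult_right_mono) auto
      then show ?thesis using False t by (simp add: c_def abs_mult)
    qed
    have "\<bar>g t - L * (1 / (1 - t))\<bar> \<le> K + e / 2 * (1 / (1 - t))"
      using norm_suminf_le[OF le sums_summable[OF c]] s c by (simp add: sums_iff)
    then have "(1 - t) * \<bar>g t - L * (1 / (1 - t))\<bar> \<le> (1 - t) * (K + e / 2 * (1 / (1 - t)))"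
      using t by (intro mult_left_mono) auto
    also have "(1 - t) * \<bar>g t - L * (1 / (1 - t))\<bar> = \<bar>(1 - t) * (g t - L * (1 / (1 - t)))\<bar>"
      using t by (simp add: abs_mult)
    also have "(1 - t) * (g t - L * (1 / (1 - t))) = (1 - t) * g t - L"
      using t by (simp add: right_diff_distrib)
    also have "(1 - t) * (K + e / 2 * (1 / (1 - t))) = (1 - t) * K + e / 2"
      using t by (simp add: field_simps)
    finally show ?thesis .
  qed
  have "((\<lambda>t. (1 - t) * K + e / 2) \<longlongrightarrow> (1 - 1) * K + e / 2) (at_left 1)"
    by (intro tendsto_intros)
  then have "eventually (\<lambda>t. (1 - t) * K + e / 2 < e) (at_left 1)"
    by (rule order_tendstoD(2)) (use e in simp)
  moreover have "eventually (\<lambda>t. t \<in> {0<..<1}) (at_left (1 :: real))"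
    by (rule eventually_at_left_real) simp
  ultimately show "eventually (\<lambda>t. dist ((1 - t) * g t) L < e) (at_left 1)"
  proof eventually_elim
    case (elim t)
    then show ?case using *[of t] by (simp add: dist_norm)
  qed
qed

lemma ell_boundary: "((\<lambda>t. (1 - t) * ell t) \<longlongrightarrow> (0 :: real)) (at_left 1)"
proof (rule abelian_limit[OF ell_coeff_tendsto_0])
  fix t :: real assume "0 < t" "t < 1"
  then show "(\<lambda>n. ell_coeff n * t ^ n) sums ell t"
    using sums_eval_fps[OF ell_conv, of t] by (simp add: ell_fps_def)
qed

lemma dell_boundary: "((\<lambda>t. (1 - t) * dell t) \<longlongrightarrow> (1 / pi :: real)) (at_left 1)"
proof (rule abelian_limit[OF Suc_ell_coeff_tendsto])
  fix t :: real assume "0 < t" "t < 1"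
  then show "(\<lambda>n. (real n + 1) * ell_coeff (Suc n) * t ^ n) sums dell t"
    using sums_eval_fps[OF dell_conv, of t] by (simp add: ell_fps_def add.commute)
qed

text \<open>The left-hand side is, up to sign, the weighted Wronskian of the solutions
  \<open>ell w\<close> and \<open>ell (1 - w)\<close> of one self-adjoint equation, hence constant
  on (0, 1). Its value is the limit at 0 from the right.\<close>

lemma legendre_relation:
  fixes w :: real
  assumes w: "0 < w" "w < 1"
  shows "ell w * (w * (1 - w) * dell (1 - w)) + w * (1 - w) * dell w * ell (1 - w) = 1 / pi"
proof -
  define L where "L w = ell w * (w * (1 - w) * dell (1 - w)) + w * (1 - w) * dell w * ell (1 - w)" for w :: real
  have d1: "((\<lambda>v::real. 1 - v) has_field_derivative - 1) (at v)" for v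
    by (auto intro!: derivative_eq_intros)
  have d: "(L has_field_derivative 0) (at v)" if "0 < v" "v < 1" for v
  proof -
    have n: "norm v < 1" "norm (1 - v) < 1" using that by auto
    have a: "((\<lambda>v. ell (1 - v)) has_field_derivative - dell (1 - v)) (at v)"
      using has_field_derivative_ell_compose[OF d1 n(2)] by simp
    have "((\<lambda>v. (1 - v) * (1 - (1 - v)) * dell (1 - v)) has_field_derivative - (ell (1 - v) / 4)) (at v)"
      using ell_ode_compose[OF d1 n(2)] by simp
    then have b: "((\<lambda>v. v * (1 - v) * dell (1 - v)) has_field_derivative - (ell (1 - v) / 4)) (at v)"
      by (simp add: mult.commute)
    show ?thesis unfolding L_def
      using DERIV_add[OF DERIV_mult[OF has_field_derivative_ell[OF n(1)] b] DERIV_mult[OF ell_ode[OF n(1)] a]]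
      by (simp add: algebra_simps)
  qed
  have const: "L v = L w" if "0 < v" "v < 1" for v
    by (rule has_field_derivative_zero_constant[of "{0<..<1}" L, THEN exE])
       (use d w that in \<open>auto intro: has_field_derivative_at_within\<close>)
  have r: "filterlim (\<lambda>v::real. 1 - v) (at_left 1) (at_right 0)"
    by (rule tendsto_imp_filterlim_at_left) (auto intro!: tendsto_eq_intros simp: eventually_at_filter)
  have c: "(ell \<longlongrightarrow> 1) (at_right (0::real))" "(dell \<longlongrightarrow> 1 / 4) (at_right (0::real))"
    using continuous_eval_fps[OF ell_conv, of "0 :: real" "{0<..}"] continuous_eval_fps[OF dell_conv, of "0 :: real" "{0<..}"]
    by (auto simp: continuous_within)
  \<comment> \<open>The factor v is written as 1 - (1 - v), so that the boundary limits apply with 1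
    - v in place of t. Only the \<open>dell (1 - v)\<close> term survives.\<close>
  have "((\<lambda>v. ell v * ((1 - v) * ((1 - (1 - v)) * dell (1 - v))) + (1 - v) * dell v * ((1 - (1 - v)) * ell (1 - v)))
      \<longlongrightarrow> 1 * ((1 - 0) * (1 / pi)) + (1 - 0) * (1 / 4) * 0) (at_right 0)"
    by (intro tendsto_intros c filterlim_compose[OF dell_boundary r] filterlim_compose[OF ell_boundary r])
  then have "(L \<longlongrightarrow> 1 / pi) (at_right 0)"
    unfolding L_def by (simp add: algebra_simps)
  moreover have "eventually (\<lambda>v. v \<in> {0<..<1}) (at_right (0 :: real))"
    by (rule eventually_at_right_real) simp
  then have "eventually (\<lambda>v. L v = L w) (at_right 0)"
    by eventually_elim (auto intro: const)
  ultimately have "((\<lambda>v. L w) \<longlongrightarrow> 1 / pi) (at_right (0::real))"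
    by (rule Lim_transform_eventually)
  then have "L w = 1 / pi"
    by (simp add: tendsto_const_iff)
  then show ?thesis by (simp add: L_def)
qed

section \<open>Brafman's formula\<close>

text \<open>A relation rather than an operator: it carries differentiability along with the value of
  z F'(z), so one chain of rules yields both holomorphy and the power series of
  \<open>G\<close>.\<close>

definition euler_deriv :: "(complex \<Rightarrow> complex) \<Rightarrow> (complex \<Rightarrow> complex) \<Rightarrow> bool" where
  "euler_deriv F G \<longleftrightarrow> (\<forall>z. norm z < 1 \<longrightarrow> (\<exists>d. (F has_field_derivative d) (at z) \<and> z * d = G z))"

lemma euler_derivI:
  "(\<And>z. norm z < 1 \<Longrightarrow> (F has_field_derivative d z) (at z)) \<Longrightarrow> (\<And>z. norm z < 1 \<Longrightarrow> z * d z = G z) \<Longrightarrow> euler_deriv F G"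
  unfolding euler_deriv_def by blast

lemma euler_deriv_cong:
  "euler_deriv F G \<Longrightarrow> (\<And>z. norm z < 1 \<Longrightarrow> G z = G' z) \<Longrightarrow> euler_deriv F G'"
  unfolding euler_deriv_def by metis

lemma euler_deriv_ident: "euler_deriv (\<lambda>z. z) (\<lambda>z. z)"
  by (rule euler_derivI[where d = "\<lambda>_. 1"]) auto

lemma euler_deriv_const: "euler_deriv (\<lambda>z. c) (\<lambda>z. 0)"
  by (rule euler_derivI[where d = "\<lambda>_. 0"]) auto

lemma euler_deriv_add:
  assumes "euler_deriv F F1" "euler_deriv G G1"
  shows "euler_deriv (\<lambda>z. F z + G z) (\<lambda>z. F1 z + G1 z)"
  unfolding euler_deriv_def
proof (intro allI impI)
  fix z :: complex assume "norm z < 1"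
  then obtain d e where *: "(F has_field_derivative d) (at z)" "z * d = F1 z"
    "(G has_field_derivative e) (at z)" "z * e = G1 z"
    using assms unfolding euler_deriv_def by blast
  show "\<exists>d. ((\<lambda>z. F z + G z) has_field_derivative d) (at z) \<and> z * d = F1 z + G1 z"
    by (intro exI[of _ "d + e"] conjI DERIV_add *) (simp add: * distrib_left)
qed

lemma euler_deriv_diff:
  assumes "euler_deriv F F1" "euler_deriv G G1"
  shows "euler_deriv (\<lambda>z. F z - G z) (\<lambda>z. F1 z - G1 z)"
  unfolding euler_deriv_def
proof (intro allI impI)
  fix z :: complex assume "norm z < 1"
  then obtain d e where *: "(F has_field_derivative d) (at z)" "z * d = F1 z"
    "(G has_field_derivative e) (at z)" "z * e = G1 z"
    using assms unfolding euler_deriv_def by blast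
  show "\<exists>d. ((\<lambda>z. F z - G z) has_field_derivative d) (at z) \<and> z * d = F1 z - G1 z"
    by (intro exI[of _ "d - e"] conjI DERIV_diff *) (simp add: * right_diff_distrib)
qed

lemma euler_deriv_mult:
  assumes "euler_deriv F F1" "euler_deriv G G1"
  shows "euler_deriv (\<lambda>z. F z * G z) (\<lambda>z. F1 z * G z + F z * G1 z)"
  unfolding euler_deriv_def
proof (intro allI impI)
  fix z :: complex assume "norm z < 1"
  then obtain d e where *: "(F has_field_derivative d) (at z)" "z * d = F1 z"
    "(G has_field_derivative e) (at z)" "z * e = G1 z"
    using assms unfolding euler_deriv_def by blast
  show "\<exists>d. ((\<lambda>z. F z * G z) has_field_derivative d) (at z) \<and> z * d = F1 z * G z + F z * G1 z"
    by (intro exI[of _ "d * G z + e * F z"] conjI DERIV_mult *) (simp add: *(2,4)[symmetric] algebra_simps)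
qed

lemma euler_deriv_divide:
  assumes "euler_deriv F F1" "euler_deriv G G1" and nz: "\<And>z. norm z < 1 \<Longrightarrow> G z \<noteq> 0"
  shows "euler_deriv (\<lambda>z. F z / G z) (\<lambda>z. (F1 z * G z - F z * G1 z) / (G z)\<^sup>2)"
  unfolding euler_deriv_def
proof (intro allI impI)
  fix z :: complex assume z: "norm z < 1"
  then obtain d e where *: "(F has_field_derivative d) (at z)" "z * d = F1 z"
    "(G has_field_derivative e) (at z)" "z * e = G1 z"
    using assms unfolding euler_deriv_def by blast
  show "\<exists>d. ((\<lambda>z. F z / G z) has_field_derivative d) (at z) \<and> z * d = (F1 z * G z - F z * G1 z) / (G z)\<^sup>2"
    by (intro exI[of _ "(d * G z - F z * e) / (G z * G z)"] conjI DERIV_divide * nz z)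
       (simp add: *(2,4)[symmetric] algebra_simps power2_eq_square)
qed

lemma euler_deriv_imp_holomorphic: "euler_deriv F G \<Longrightarrow> F holomorphic_on ball 0 1"
  unfolding euler_deriv_def by (auto simp: holomorphic_on_open)

text \<open>This passes from analytic identities to coefficients: z d/dz multiplies the n-th Taylor
  coefficient by n.\<close>

lemma euler_deriv_imp_has_fps_expansion:
  assumes "euler_deriv F G" "F has_fps_expansion a"
  shows "G has_fps_expansion fps_XD a"
proof -
  have 1: "(\<lambda>z. z * deriv F z) has_fps_expansion (fps_X * fps_deriv a)"
    by (intro fps_expansion_intros assms)
  have "eventually (\<lambda>z. z \<in> ball 0 1) (nhds (0 :: complex))"
    by (intro eventually_nhds_in_open) auto
  then have 2: "eventually (\<lambda>z. z * deriv F z = G z) (nhds 0)"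
  proof eventually_elim
    case (elim z)
    then show ?case using assms(1) DERIV_imp_deriv unfolding euler_deriv_def by fastforce
  qed
  show ?thesis
    using 1 has_fps_expansion_cong[OF 2 refl, of "fps_X * fps_deriv a"] by (simp add: fps_XD_def)
qed

text \<open>
  The quadratic with roots \<open>a = (1 - z - r)/2\<close> and \<open>a' = (1 - z + r)/2\<close> gives \<open>z (a - s) = a (1 - a)\<close> and
  \<open>a a' = - z s\<close> with \<open>s = (1 - x)/2\<close>. If \<open>|a| \<ge> 1\<close>, the first identity forces \<open>Re a > (1 + s)/2\<close> and the
  second one \<open>|a'| \<le> s\<close>, so that \<open>a\<close> would lie to the right of \<open>a'\<close>, against \<open>Re r > 0\<close>.
\<close>

lemma brafman_argument_bound:
  fixes x :: real and z r :: complex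
  assumes x: "\<bar>x\<bar> < 1" and z: "norm z < 1"
    and r: "r\<^sup>2 = 1 - 2 * of_real x * z + z\<^sup>2" "Re r > 0"
  shows "norm ((1 - r - z) / 2) < 1"
proof (rule ccontr)
  define a where "a = (1 - r - z) / 2"
  define a' where "a' = (1 + r - z) / 2"
  define s where "s = (1 - x) / 2"
  have s: "0 < s" "s < 1" using x by (auto simp: s_def)
  assume "\<not> norm ((1 - r - z) / 2) < 1"
  then have a1: "norm a \<ge> 1" by (simp add: a_def)
  have "a * a' = ((1 - z)\<^sup>2 - r\<^sup>2) / 4"
    by (simp add: a_def a'_def power2_eq_square algebra_simps)
  also have "\<dots> = - (z * of_real s)"
    unfolding r by (simp add: s_def power2_eq_square field_simps)
  finally have prod: "a * a' = - (z * of_real s)" .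
  have a': "a' = 1 - z - a"
    by (simp add: a_def a'_def field_simps)
  have eq: "z * (a - of_real s) = a * (1 - a)"
    using prod unfolding a' by (simp add: algebra_simps)
  have ns: "a \<noteq> of_real s" using a1 s by auto
  have "norm (1 - a) \<le> norm a * norm (1 - a)"
    using a1 mult_right_mono[of 1 "norm a" "norm (1 - a)"] by simp
  also have "\<dots> = norm z * norm (a - of_real s)"
    using eq by (metis norm_mult)
  also have "\<dots> < 1 * norm (a - of_real s)"
    using z ns by (intro mult_strict_right_mono) auto
  finally have "(norm (1 - a))\<^sup>2 < (norm (a - of_real s))\<^sup>2"
    by (intro power_strict_mono) auto
  then have "(1 + s) * (1 - s) < 2 * Re a * (1 - s)"
    unfolding cmod_power2 by (simp add: power2_eq_square algebra_simps)
  then have "1 + s < 2 * Re a"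
    using s by simp
  moreover have "Re a < Re a'" using r(2) by (simp add: a_def a'_def)
  moreover have "norm a' \<le> s"
  proof -
    have "norm a' \<le> norm a * norm a'"
      using a1 mult_right_mono[of 1 "norm a" "norm a'"] by simp
    also have "\<dots> = norm z * s"
      using prod s by (simp add: norm_mult[symmetric]) (simp add: norm_mult)
    also have "\<dots> \<le> s" using z s by (simp add: mult_left_le_one_le)
    finally show ?thesis .
  qed
  moreover have "Re a' \<le> norm a'" by (rule complex_Re_le_cmod)
  ultimately show False using s by linarith
qed

text \<open>Keeps the discriminant off the branch cut of \<open>csqrt\<close>. If it is real, then
  either z is real and it equals (z - x)^2 + 1 - x^2, or Re z = x and it equals 1 - |z|^2; both are
  positive.\<close>

lemma legendre_discriminant_not_nonpos:
  fixes x :: real and z :: complex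
  assumes x: "\<bar>x\<bar> < 1" and z: "norm z < 1"
  shows "1 - 2 * of_real x * z + z\<^sup>2 \<notin> \<real>\<^sub>\<le>\<^sub>0"
proof
  assume "1 - 2 * of_real x * z + z\<^sup>2 \<in> \<real>\<^sub>\<le>\<^sub>0"
  then have re: "1 - 2 * x * Re z + ((Re z)\<^sup>2 - (Im z)\<^sup>2) \<le> 0" and im: "Im z * (Re z - x) = 0"
    by (auto simp: complex_nonpos_Reals_iff power2_eq_square algebra_simps)
  have x2: "x\<^sup>2 < 1" using x by (simp add: abs_square_less_1)
  have z2: "(Re z)\<^sup>2 + (Im z)\<^sup>2 < 1"
    using z by (metis cmod_power2 abs_norm_cancel abs_square_less_1)
  show False
  proof (cases "Im z = 0")
    case True
    then show False using re x2 zero_le_power2[of "Re z - x"] by (simp add: power2_diff algebra_simps)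
  next
    case False
    then have "Re z = x" using im by simp
    then show False using re z2 by (simp add: power2_eq_square algebra_simps)
  qed
qed

text \<open>
  With \<open>\<theta> = z d/dz\<close> at fixed \<open>x\<close> one has \<open>rho \<theta> = \<alpha> (1 - \<alpha>) d/d\<alpha> + \<beta> (1 - \<beta>) d/d\<beta>\<close>. The suffix 1 on \<open>ell_alpha\<close>
  and \<open>ell_beta\<close> marks the derivative \<open>\<alpha> (1 - \<alpha>) d/d\<alpha>\<close>, because this operator squares to
  multiplication by \<open>\<alpha> (1 - \<alpha>) / 4\<close> on \<open>ell \<alpha>\<close>; \<open>brafman_theta1\<close>, \<open>brafman_theta2\<close>, \<open>brafman_theta3\<close> are \<open>\<theta> brafman\<close>, \<open>\<theta>\<^sup>2 brafman\<close>, \<open>\<theta>\<^sup>3 brafman\<close>.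
\<close>

definition rho :: "real \<Rightarrow> complex \<Rightarrow> complex" where
  "rho x z = csqrt (1 - 2 * of_real x * z + z\<^sup>2)"

definition alpha :: "real \<Rightarrow> complex \<Rightarrow> complex" where "alpha x z = (1 - rho x z - z) / 2"

definition beta :: "real \<Rightarrow> complex \<Rightarrow> complex" where "beta x z = (1 - rho x z + z) / 2"

definition ell_alpha :: "real \<Rightarrow> complex \<Rightarrow> complex" where "ell_alpha x z = ell (alpha x z)"
definition ell_alpha1 :: "real \<Rightarrow> complex \<Rightarrow> complex" where "ell_alpha1 x z = alpha x z * (1 - alpha x z) * dell (alpha x z)"
definition ell_beta :: "real \<Rightarrow> complex \<Rightarrow> complex" where "ell_beta x z = ell (beta x z)"
definition ell_beta1 :: "real \<Rightarrow> complex \<Rightarrow> complex" where "ell_beta1 x z = beta x z * (1 - beta x z) * dell (beta x z)"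

definition brafman :: "real \<Rightarrow> complex \<Rightarrow> complex" where "brafman x z = ell_alpha x z * ell_beta x z"
definition brafman_sum :: "real \<Rightarrow> complex \<Rightarrow> complex" where "brafman_sum x z = ell_alpha1 x z * ell_beta x z + ell_alpha x z * ell_beta1 x z"
definition brafman_prod :: "real \<Rightarrow> complex \<Rightarrow> complex" where "brafman_prod x z = ell_alpha1 x z * ell_beta1 x z"
definition brafman_diff :: "real \<Rightarrow> complex \<Rightarrow> complex" where "brafman_diff x z = ell_alpha x z * ell_beta1 x z - ell_alpha1 x z * ell_beta x z"
definition brafman_theta1 :: "real \<Rightarrow> complex \<Rightarrow> complex" where "brafman_theta1 x z = brafman_sum x z / rho x z"
definition brafman_theta2 :: "real \<Rightarrow> complex \<Rightarrow> complex" where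
  "brafman_theta2 x z = (2 * brafman_prod x z + z * (of_real x - z) * (brafman_theta1 x z + brafman x z / 4)) / (1 - 2 * of_real x * z + z\<^sup>2)"
definition brafman_theta3 :: "real \<Rightarrow> complex \<Rightarrow> complex" where
  "brafman_theta3 x z = (3 * z * (of_real x - z) * brafman_theta2 x z + z * (of_real x - 2 * z) * (brafman_theta1 x z + brafman x z / 4)
      + z * (of_real x - z) / 2 * brafman_theta1 x z - z * brafman_diff x z / 4) / (1 - 2 * of_real x * z + z\<^sup>2)"

section \<open>Algebraic identities and Euler derivatives of the Brafman product\<close>

lemma rho_square: "(rho x z)\<^sup>2 = 1 - 2 * of_real x * z + z\<^sup>2"
  by (simp add: rho_def)

text \<open>The right-hand side is z times \<open>rho\<close> times the derivative of
  \<open>alpha\<close>, so this says that \<open>rho\<close> times the Euler derivative of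
  \<open>alpha\<close> is \<open>alpha\<close> (1 - \<open>alpha\<close>). The same holds for
  \<open>beta_id\<close>.\<close>

lemma alpha_id: "alpha x z * (1 - alpha x z) = z * (of_real x - z - rho x z) / 2"
proof -
  have "alpha x z * (1 - alpha x z) = (1 - (rho x z)\<^sup>2 - 2 * rho x z * z - z\<^sup>2) / 4"
    by (simp add: alpha_def power2_eq_square field_simps)
  also have "1 - (rho x z)\<^sup>2 - 2 * rho x z * z - z\<^sup>2 = 2 * (z * (of_real x - z - rho x z))"
    unfolding rho_square by (simp add: power2_eq_square algebra_simps)
  finally show ?thesis by simp
qed

lemma beta_id: "beta x z * (1 - beta x z) = z * (of_real x - z + rho x z) / 2"
proof -
  have "beta x z * (1 - beta x z) = (1 - (rho x z)\<^sup>2 + 2 * rho x z * z - z\<^sup>2) / 4"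
    by (simp add: beta_def power2_eq_square field_simps)
  also have "1 - (rho x z)\<^sup>2 + 2 * rho x z * z - z\<^sup>2 = 2 * (z * (of_real x - z + rho x z))"
    unfolding rho_square by (simp add: power2_eq_square algebra_simps)
  finally show ?thesis by simp
qed

context
  fixes x :: real
  assumes x: "\<bar>x\<bar> < 1"
begin

lemma rho_Re_pos:
  assumes "norm z < 1"
  shows "Re (rho x z) > 0"
proof (rule ccontr)
  assume "\<not> Re (rho x z) > 0"
  then have "Re (rho x z) = 0"
    using csqrt_principal[of "1 - 2 * of_real x * z + z\<^sup>2"] by (auto simp: rho_def)
  then have "(rho x z)\<^sup>2 \<in> \<real>\<^sub>\<le>\<^sub>0"
    by (auto simp: complex_nonpos_Reals_iff power2_eq_square)
  then show False
    using legendre_discriminant_not_nonpos[OF x assms] by (simp add: rho_square)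
qed

lemma rho_nonzero: "norm z < 1 \<Longrightarrow> rho x z \<noteq> 0"
  using rho_Re_pos[of z] by auto

lemma discriminant_nonzero: "norm (z :: complex) < 1 \<Longrightarrow> 1 - 2 * of_real x * z + z\<^sup>2 \<noteq> 0"
  using legendre_discriminant_not_nonpos[OF x, of z] by auto

lemma norm_alpha: "norm z < 1 \<Longrightarrow> norm (alpha x z) < 1"
  unfolding alpha_def by (rule brafman_argument_bound[OF x _ rho_square rho_Re_pos])

lemma norm_beta:
  assumes "norm z < 1" shows "norm (beta x z) < 1"
  \<comment> \<open>The map (x, z) to (-x, -z) preserves \<open>rho\<close> and exchanges
    \<open>alpha\<close> with \<open>beta\<close>.\<close>
  using brafman_argument_bound[of "-x" "-z" "rho x z"] x assms
  by (simp add: beta_def rho_square rho_Re_pos)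

lemma rho_deriv:
  assumes "norm z < 1"
  shows "(rho x has_field_derivative (z - of_real x) / rho x z) (at z)"
proof -
  have "((\<lambda>z. 1 - 2 * of_real x * z + z\<^sup>2) has_field_derivative (2 * z - 2 * of_real x)) (at z)"
    by (auto intro!: derivative_eq_intros)
  from DERIV_chain2[OF has_field_derivative_csqrt[OF legendre_discriminant_not_nonpos[OF x assms]] this]
  have "(rho x has_field_derivative (inverse (2 * rho x z) * (2 * z - 2 * of_real x))) (at z)"
    unfolding rho_def by simp
  also have "inverse (2 * rho x z) * (2 * z - 2 * of_real x) = (z - of_real x) / rho x z"
    using rho_nonzero[OF assms] by (simp add: field_simps)
  finally show ?thesis .
qed

lemma alpha_deriv:
  "norm z < 1 \<Longrightarrow> (alpha x has_field_derivative (of_real x - z - rho x z) / (2 * rho x z)) (at z)"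
  unfolding alpha_def
  by (auto intro!: derivative_eq_intros rho_deriv simp: rho_nonzero divide_simps)

lemma beta_deriv:
  "norm z < 1 \<Longrightarrow> (beta x has_field_derivative (of_real x - z + rho x z) / (2 * rho x z)) (at z)"
  unfolding beta_def
  by (auto intro!: derivative_eq_intros rho_deriv simp: rho_nonzero divide_simps)

lemma euler_rho: "euler_deriv (rho x) (\<lambda>z. - z * (of_real x - z) / rho x z)"
  by (rule euler_derivI[OF rho_deriv]) (auto simp: algebra_simps)

lemma euler_ell_alpha: "euler_deriv (ell_alpha x) (\<lambda>z. ell_alpha1 x z / rho x z)"
  unfolding ell_alpha_def[abs_def]
  by (rule euler_derivI[OF has_field_derivative_ell_compose[OF alpha_deriv norm_alpha]])
     (simp_all add: ell_alpha1_def alpha_id)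

lemma euler_ell_beta: "euler_deriv (ell_beta x) (\<lambda>z. ell_beta1 x z / rho x z)"
  unfolding ell_beta_def[abs_def]
  by (rule euler_derivI[OF has_field_derivative_ell_compose[OF beta_deriv norm_beta]])
     (simp_all add: ell_beta1_def beta_id)

lemma euler_ell_alpha1: "euler_deriv (ell_alpha1 x) (\<lambda>z. z * (of_real x - z - rho x z) * ell_alpha x z / (8 * rho x z))"
  unfolding ell_alpha1_def[abs_def]
  by (rule euler_derivI[OF ell_ode_compose[OF alpha_deriv norm_alpha]])
     (simp_all add: ell_alpha_def)

lemma euler_ell_beta1: "euler_deriv (ell_beta1 x) (\<lambda>z. z * (of_real x - z + rho x z) * ell_beta x z / (8 * rho x z))"
  unfolding ell_beta1_def[abs_def]
  by (rule euler_derivI[OF ell_ode_compose[OF beta_deriv norm_beta]])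
     (simp_all add: ell_beta_def)

lemma euler_brafman: "euler_deriv (brafman x) (brafman_theta1 x)"
  unfolding brafman_def[abs_def]
  by (rule euler_deriv_cong[OF euler_deriv_mult[OF euler_ell_alpha euler_ell_beta]])
     (simp add: brafman_theta1_def brafman_sum_def add_divide_distrib)

text \<open>The mixed terms \<open>ell_alpha1\<close> \<open>ell_beta1\<close> cancel, and the
  difference of \<beta>(1 - \<beta>) and \<alpha>(1 - \<alpha>) is z \<open>rho\<close>, so the
  square root disappears. This keeps the system for \<open>brafman\<close>,
  \<open>brafman_prod\<close> and \<open>brafman_diff\<close> polynomial in z apart from the
  discriminant.\<close>

lemma euler_brafman_diff: "euler_deriv (brafman_diff x) (\<lambda>z. z * brafman x z / 4)"
  unfolding brafman_diff_def[abs_def]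
proof (rule euler_deriv_cong[OF euler_deriv_diff[OF euler_deriv_mult[OF euler_ell_alpha euler_ell_beta1] euler_deriv_mult[OF euler_ell_alpha1 euler_ell_beta]]])
  fix z :: complex assume "norm z < 1"
  note r = rho_nonzero[OF this]
  show "ell_alpha1 x z / rho x z * ell_beta1 x z + ell_alpha x z * (z * (of_real x - z + rho x z) * ell_beta x z / (8 * rho x z)) -
      (z * (of_real x - z - rho x z) * ell_alpha x z / (8 * rho x z) * ell_beta x z + ell_alpha1 x z * (ell_beta1 x z / rho x z)) = z * brafman x z / 4"
    using r by (simp add: brafman_def divide_simps) (simp add: algebra_simps)
qed

lemma euler_brafman_prod: "euler_deriv (brafman_prod x) (\<lambda>z. z * (of_real x - z) / 8 * brafman_theta1 x z - z * brafman_diff x z / 8)"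
  unfolding brafman_prod_def[abs_def]
proof (rule euler_deriv_cong[OF euler_deriv_mult[OF euler_ell_alpha1 euler_ell_beta1]])
  fix z :: complex assume "norm z < 1"
  note r = rho_nonzero[OF this]
  show "z * (of_real x - z - rho x z) * ell_alpha x z / (8 * rho x z) * ell_beta1 x z + ell_alpha1 x z * (z * (of_real x - z + rho x z) * ell_beta x z / (8 * rho x z)) =
      z * (of_real x - z) / 8 * brafman_theta1 x z - z * brafman_diff x z / 8"
    using r by (simp add: brafman_theta1_def brafman_sum_def brafman_diff_def divide_simps) (simp add: algebra_simps)
qed

text \<open>Here the sum of \<alpha>(1 - \<alpha>) and \<beta>(1 - \<beta>) enters, which is z(x -
  z), while the mixed terms add up to twice \<open>brafman_prod\<close>.\<close>

lemma euler_brafman_sum: "euler_deriv (brafman_sum x) (\<lambda>z. (z * (of_real x - z) * brafman x z / 4 + 2 * brafman_prod x z) / rho x z)"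
  unfolding brafman_sum_def[abs_def]
proof (rule euler_deriv_cong[OF euler_deriv_add[OF euler_deriv_mult[OF euler_ell_alpha1 euler_ell_beta] euler_deriv_mult[OF euler_ell_alpha euler_ell_beta1]]])
  fix z :: complex assume "norm z < 1"
  note r = rho_nonzero[OF this]
  show "z * (of_real x - z - rho x z) * ell_alpha x z / (8 * rho x z) * ell_beta x z + ell_alpha1 x z * (ell_beta1 x z / rho x z) +
      (ell_alpha1 x z / rho x z * ell_beta1 x z + ell_alpha x z * (z * (of_real x - z + rho x z) * ell_beta x z / (8 * rho x z))) =
      (z * (of_real x - z) * brafman x z / 4 + 2 * brafman_prod x z) / rho x z"
    using r by (simp add: brafman_def brafman_prod_def divide_simps) (simp add: algebra_simps)
qed

lemma euler_brafman_theta1: "euler_deriv (brafman_theta1 x) (brafman_theta2 x)"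
  unfolding brafman_theta1_def[abs_def]
proof (rule euler_deriv_cong[OF euler_deriv_divide[OF euler_brafman_sum euler_rho rho_nonzero]])
  fix z :: complex assume z: "norm z < 1"
  note r = rho_nonzero[OF this]
  have "((z * (of_real x - z) * brafman x z / 4 + 2 * brafman_prod x z) / rho x z * rho x z - brafman_sum x z * (- z * (of_real x - z) / rho x z)) / (rho x z)\<^sup>2 =
    (z * (of_real x - z) * brafman x z / 4 + 2 * brafman_prod x z + z * (of_real x - z) * brafman_theta1 x z) / (rho x z)\<^sup>2"
    using r by (simp add: brafman_theta1_def)
  also have "\<dots> = brafman_theta2 x z"
    by (simp add: brafman_theta2_def rho_square algebra_simps)
  finally show "((z * (of_real x - z) * brafman x z / 4 + 2 * brafman_prod x z) / rho x z * rho x z - brafman_sum x z * (- z * (of_real x - z) / rho x z)) / (rho x z)\<^sup>2 = brafman_theta2 x z" .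
qed simp

lemma euler_brafman_theta2: "euler_deriv (brafman_theta2 x) (brafman_theta3 x)"
proof -
  let ?X = "of_real x :: complex"
  have zx: "euler_deriv (\<lambda>z. z * (?X - z)) (\<lambda>z. z * (?X - z) + z * (0 - z))"
    by (intro euler_deriv_mult euler_deriv_diff euler_deriv_ident euler_deriv_const)
  have N: "euler_deriv (\<lambda>z. 2 * brafman_prod x z + z * (?X - z) * (brafman_theta1 x z + brafman x z / 4))
     (\<lambda>z. (0 * brafman_prod x z + 2 * (z * (of_real x - z) / 8 * brafman_theta1 x z - z * brafman_diff x z / 8)) +
        ((z * (?X - z) + z * (0 - z)) * (brafman_theta1 x z + brafman x z / 4) + z * (?X - z) * (brafman_theta2 x z + (brafman_theta1 x z * 4 - brafman x z * 0) / 4\<^sup>2)))"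
    by (intro euler_deriv_add euler_deriv_mult[OF euler_deriv_const euler_brafman_prod] euler_deriv_mult[OF zx] euler_brafman_theta1
       euler_deriv_divide euler_brafman euler_deriv_const) simp
  have R: "euler_deriv (\<lambda>z. 1 - 2 * ?X * z + z\<^sup>2) (\<lambda>z. 0 - (0 * z + 2 * ?X * z) + (z * z + z * z))"
    unfolding power2_eq_square
    by (intro euler_deriv_add euler_deriv_diff euler_deriv_mult euler_deriv_const euler_deriv_ident)
  show ?thesis
    unfolding brafman_theta2_def[abs_def]
  proof (rule euler_deriv_cong[OF euler_deriv_divide[OF N R discriminant_nonzero]])
    fix z :: complex assume z: "norm z < 1"
    define D where "D = 1 - 2 * ?X * z + z\<^sup>2"
    have D: "D \<noteq> 0" using discriminant_nonzero[OF z] by (simp add: D_def)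
    \<comment> \<open>Recognising the numerator as \<open>brafman_theta2\<close> times
      \<open>D\<close> lets one factor \<open>D\<close> cancel in the quotient rule.\<close>
    have n: "2 * brafman_prod x z + z * (?X - z) * (brafman_theta1 x z + brafman x z / 4) = brafman_theta2 x z * D"
      using D by (simp add: brafman_theta2_def D_def)
    have d: "(A * D - brafman_theta2 x z * D * B) / D\<^sup>2 = (A - brafman_theta2 x z * B) / D" for A B
      using D by (simp add: field_simps power2_eq_square)
    show "((0 * brafman_prod x z + 2 * (z * (of_real x - z) / 8 * brafman_theta1 x z - z * brafman_diff x z / 8) +
        ((z * (?X - z) + z * (0 - z)) * (brafman_theta1 x z + brafman x z / 4) + z * (?X - z) * (brafman_theta2 x z + (brafman_theta1 x z * 4 - brafman x z * 0) / 4\<^sup>2))) *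
        (1 - 2 * ?X * z + z\<^sup>2) - (2 * brafman_prod x z + z * (?X - z) * (brafman_theta1 x z + brafman x z / 4)) * (0 - (0 * z + 2 * ?X * z) + (z * z + z * z))) /
        (1 - 2 * ?X * z + z\<^sup>2)\<^sup>2 = brafman_theta3 x z"
      unfolding brafman_theta3_def n D_def[symmetric] d
      by (rule arg_cong[where f = "\<lambda>t. t / D"]) (simp add: field_simps)
  qed
qed

text \<open>The earlier functions are holomorphic because they have an Euler derivative; this one
  ends the chain, so holomorphy is read off its formula.\<close>

lemma brafman_theta3_holomorphic: "brafman_theta3 x holomorphic_on ball 0 1"
  unfolding brafman_theta3_def[abs_def] using discriminant_nonzero
  by (intro holomorphic_intros euler_deriv_imp_holomorphic[OF euler_brafman] euler_deriv_imp_holomorphic[OF euler_brafman_theta1]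
     euler_deriv_imp_holomorphic[OF euler_brafman_theta2] euler_deriv_imp_holomorphic[OF euler_brafman_diff]) auto

end

section \<open>Recurrences for Legendre polynomials and for the Brafman coefficients\<close>

lemma fps_XD_nth: "fps_nth (fps_XD a) n = of_nat n * fps_nth (a :: 'a :: comm_ring_1 fps) n"
  by (cases n) (simp_all add: fps_XD_nth)

text \<open>A common upper summation bound allows three consecutive Legendre polynomials to be
  combined term by term.\<close>

lemma legendre_P_eq_sum_le:
  assumes "n \<le> N"
  shows "legendre_P n x =
     (\<Sum>m\<le>N. pochhammer (- real n) m * pochhammer (real n + 1) m / (fact m)\<^sup>2 * ((1 - x) / 2) ^ m)"
  unfolding legendre_P_eq_sum
  by (rule sum.mono_neutral_left) (use assms in \<open>auto simp: pochhammer_of_nat_eq_0_iff\<close>)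

lemma legendre_P_0 [simp]: "legendre_P 0 x = 1"
  by (simp add: legendre_P_eq_sum)

lemma legendre_P_1 [simp]: "legendre_P (Suc 0) x = x"
  by (simp add: legendre_P_eq_sum field_simps)

text \<open>This is Bonnet's recurrence at the power t^(j+1), where x = 1 - 2t. After shifting the
  Pochhammer symbols, all four coefficients are \<open>U * V / F\<close> times a rational function
  of a and j, and a polynomial identity remains.\<close>

lemma legendre_coeff_rec:
  fixes a :: real
  assumes "a > 0"
  defines "c \<equiv> \<lambda>a j. pochhammer (- a) j * pochhammer (a + 1) j / (fact j)\<^sup>2"
  shows "(a + 1) * c (a + 1) (Suc j) - (2 * a + 1) * c a (Suc j) + 2 * (2 * a + 1) * c a j + a * c (a - 1) (Suc j) = 0"
proof -
  define U where "U = pochhammer (- a) j"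
  define V where "V = pochhammer (a + 1) j"
  have u1: "pochhammer (- a) (Suc j) = U * (j - a)"
    by (simp add: U_def pochhammer_Suc)
  have v1: "pochhammer (a + 1) (Suc j) = V * (a + 1 + j)"
    by (simp add: V_def pochhammer_Suc)
  have u2: "pochhammer (- (a + 1)) (Suc j) = - (a + 1) * U"
    by (simp add: U_def pochhammer_rec)
  have v0: "pochhammer (a - 1 + 1) (Suc j) = a * V"
    by (simp add: V_def pochhammer_rec)
  \<comment> \<open>The extra factor -a completes the symbol to one starting at -a, so that
    \<open>U\<close> can be split off.\<close>
  have "(- a) * pochhammer (- (a - 1)) (Suc j) = pochhammer (- a) (Suc (Suc j))"
    by (subst pochhammer_rec) simp
  also have "\<dots> = U * (j - a) * (j + 1 - a)"
    by (subst pochhammer_Suc) (simp add: u1)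
  finally have u0: "pochhammer (- (a - 1)) (Suc j) = - (U * (j - a) * (j + 1 - a)) / a"
    using assms by (simp add: field_simps)
  have "(a + 1) * pochhammer (a + 1 + 1) (Suc j) = pochhammer (a + 1) (Suc (Suc j))"
    by (subst pochhammer_rec[of "a + 1"]) simp
  also have "\<dots> = V * (a + 1 + j) * (a + 2 + j)"
    by (subst pochhammer_Suc) (simp add: v1)
  finally have v2: "pochhammer (a + 1 + 1) (Suc j) = V * (a + 1 + j) * (a + 2 + j) / (a + 1)"
    using assms by (simp add: field_simps)
  define F :: real where "F = (fact (Suc j))\<^sup>2"
  have F0: "F \<noteq> 0" by (simp add: F_def)
  have c2: "c (a + 1) (Suc j) = - (U * V * (a + 1 + j) * (a + 2 + j)) / F"
  proof -
    have aux: "- s * U * (V * p * q / s) / F = - (U * V * p * q) / F" if "s \<noteq> 0" for s p q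
      using that by simp
    show ?thesis
      unfolding c_def u2 v2 F_def[symmetric] by (rule aux) (use assms in simp)
  qed
  have c1: "c a (Suc j) = U * V * (j - a) * (a + 1 + j) / F"
    unfolding c_def u1 v1 F_def[symmetric] by simp
  have c0: "c (a - 1) (Suc j) = - (U * V * (j - a) * (j + 1 - a)) / F"
    unfolding c_def u0 v0 F_def[symmetric] using assms F0 by (simp add: field_simps)
  have cj: "c a j = U * V * (j + 1)\<^sup>2 / F"
    unfolding c_def U_def[symmetric] V_def[symmetric] F_def
    by (simp add: power_mult_distrib)
  have "(a + 1) * c (a + 1) (Suc j) - (2 * a + 1) * c a (Suc j) + 2 * (2 * a + 1) * c a j + a * c (a - 1) (Suc j) =
    U * V * (- (a + 1) * (a + 1 + j) * (a + 2 + j) - (2 * a + 1) * (j - a) * (a + 1 + j)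
      + 2 * (2 * a + 1) * (j + 1)\<^sup>2 - a * (j - a) * (j + 1 - a)) / F"
    unfolding c2 c1 c0 cj using F0 by (simp add: divide_simps) (simp add: algebra_simps)
  also have "\<dots> = 0"
    by (simp add: power2_eq_square algebra_simps)
  finally show ?thesis .
qed

text \<open>Bonnet's recurrence, obtained by summing \<open>legendre_coeff_rec\<close> with a = m +
  1 against t^(j+1). The constant terms match because (m + 2) + (m + 1) = 2m + 3.\<close>

lemma legendre_P_rec:
  "(real m + 2) * legendre_P (Suc (Suc m)) x =
     (2 * real m + 3) * x * legendre_P (Suc m) x - (real m + 1) * legendre_P m x"
proof -
  define t where "t = (1 - x) / 2"
  define c where "c = (\<lambda>(a::real) j. pochhammer (- a) j * pochhammer (a + 1) j / (fact j)\<^sup>2)"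
  have c0: "c a 0 = 1" for a by (simp add: c_def)
  have P: "legendre_P n x = 1 + (\<Sum>j\<le>Suc m. c (real n) (Suc j) * t ^ Suc j)" if "n \<le> Suc (Suc m)" for n
  proof -
    have "legendre_P n x = (\<Sum>j\<le>Suc (Suc m). c (real n) j * t ^ j)"
      unfolding legendre_P_eq_sum_le[OF that] c_def t_def by simp
    also have "\<dots> = c (real n) 0 * t ^ 0 + (\<Sum>j\<le>Suc m. c (real n) (Suc j) * t ^ Suc j)"
      by (rule sum.atMost_Suc_shift)
    finally show ?thesis by (simp add: c0)
  qed
  have Pt: "t * legendre_P (Suc m) x = (\<Sum>j\<le>Suc m. c (real m + 1) j * t ^ Suc j)"
    unfolding legendre_P_eq_sum c_def t_def sum_distrib_left
    by (intro sum.cong) (simp_all add: algebra_simps)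
  have x: "x = 1 - 2 * t" by (simp add: t_def field_simps)
  have e: "real (Suc (Suc m)) = real m + 1 + 1" "real (Suc m) = real m + 1" by auto
  define S where "S = (\<lambda>a. \<Sum>j\<le>Suc m. c a (Suc j) * t ^ Suc j)"
  define S' where "S' = (\<Sum>j\<le>Suc m. c (real m + 1) j * t ^ Suc j)"
  have "(real m + 2) * S (real m + 1 + 1) - (2 * real m + 3) * S (real m + 1)
      + 2 * (2 * real m + 3) * S' + (real m + 1) * S (real m + 1 - 1) =
     (\<Sum>j\<le>Suc m. ((real m + 2) * c (real m + 1 + 1) (Suc j) - (2 * real m + 3) * c (real m + 1) (Suc j)
       + 2 * (2 * real m + 3) * c (real m + 1) j + (real m + 1) * c (real m + 1 - 1) (Suc j)) * t ^ Suc j)"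
    unfolding S_def S'_def sum_distrib_left sum.distrib[symmetric] sum_subtractf[symmetric]
    by (intro sum.cong) (simp_all add: algebra_simps)
  also have "\<dots> = 0"
    using legendre_coeff_rec[of "real m + 1"]
    by (intro sum.neutral) (simp add: c_def algebra_simps)
  finally have Z: "(real m + 2) * S (real m + 1 + 1) - (2 * real m + 3) * S (real m + 1)
      + 2 * (2 * real m + 3) * S' + (real m + 1) * S (real m + 1 - 1) = 0" .
  have 2: "legendre_P (Suc (Suc m)) x = 1 + S (real m + 1 + 1)"
    using P[of "Suc (Suc m)"] unfolding S_def e by simp
  have 1: "legendre_P (Suc m) x = 1 + S (real m + 1)"
    using P[of "Suc m"] unfolding S_def e by simp
  have 0: "legendre_P m x = 1 + S (real m + 1 - 1)"
    using P[of m] unfolding S_def by simp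
  have "(2 * real m + 3) * x * legendre_P (Suc m) x =
      (2 * real m + 3) * legendre_P (Suc m) x - 2 * (2 * real m + 3) * (t * legendre_P (Suc m) x)"
    by (subst x) (simp add: algebra_simps)
  also have "\<dots> = (2 * real m + 3) * (1 + S (real m + 1)) - 2 * (2 * real m + 3) * S'"
    unfolding Pt S'_def[symmetric] unfolding 1 ..
  finally show ?thesis
    unfolding 2 0 using Z by (simp add: algebra_simps)
qed

text \<open>Bonnet's recurrence weighted by the ratios of \<open>ell_coeff\<close>, normalised to
  agree literally with the recurrence that the differential system gives for the product.\<close>

lemma brafman_coeff_rec:
  fixes x :: real
  defines "u \<equiv> \<lambda>n. ell_coeff n * legendre_P n x"
  shows "8 * (real m + 1) * (real m + 2) ^ 3 * u (Suc (Suc m)) =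
     2 * (real m + 1) * x * (2 * real m + 3) ^ 3 * u (Suc m)
     - (2 * real m + 1)\<^sup>2 * (2 * real m + 3)\<^sup>2 / 2 * u m"
proof -
  have A2: "(real m + 2)\<^sup>2 * ell_coeff (Suc (Suc m)) = (2 * real m + 3)\<^sup>2 / 4 * ell_coeff (Suc m)"
    using ell_coeff_rec[of "Suc m"] by (simp add: power2_eq_square field_simps)
  have A1: "(real m + 1)\<^sup>2 * ell_coeff (Suc m) = (2 * real m + 1)\<^sup>2 / 4 * ell_coeff m"
    using ell_coeff_rec[of m] by (simp add: power2_eq_square field_simps)
  have "8 * (real m + 1) * (real m + 2) ^ 3 * u (Suc (Suc m)) =
    8 * (real m + 1) * ((real m + 2)\<^sup>2 * ell_coeff (Suc (Suc m))) * ((real m + 2) * legendre_P (Suc (Suc m)) x)"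
    by (simp add: u_def power3_eq_cube power2_eq_square)
  also have "\<dots> = 2 * (2 * real m + 3)\<^sup>2 * (real m + 1) * (2 * real m + 3) * x * (ell_coeff (Suc m) * legendre_P (Suc m) x)
     - 2 * (2 * real m + 3)\<^sup>2 * ((real m + 1)\<^sup>2 * ell_coeff (Suc m)) * legendre_P m x"
    unfolding A2 legendre_P_rec by (simp add: power2_eq_square field_simps)
  also have "\<dots> = 2 * (real m + 1) * x * (2 * real m + 3) ^ 3 * u (Suc m)
     - (2 * real m + 1)\<^sup>2 * (2 * real m + 3)\<^sup>2 / 2 * u m"
    unfolding A1 u_def by (simp add: power2_eq_square power3_eq_cube field_simps)
  finally show ?thesis .
qed

section \<open>Taylor coefficients of the Brafman product\<close>

context
  fixes x :: real
  assumes x: "\<bar>x\<bar> < 1"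
begin

text \<open>The product, \<open>brafman_prod\<close> and \<open>brafman_diff\<close> satisfy three
  linear Euler equations. Eliminating the coefficients of the last two leaves a three-term
  recurrence for those of the product, which is the one in \<open>brafman_coeff_rec\<close>; the
  first two coefficients agree as well.\<close>

lemma brafman_expansion: "brafman x has_fps_expansion Abs_fps (\<lambda>n. of_real (ell_coeff n * legendre_P n x))"
proof -
  let ?X = "of_real x :: complex"
  define h where "h = fps_expansion (brafman x) 0"
  define t where "t = fps_expansion (brafman_prod x) 0"
  define w where "w = fps_expansion (brafman_diff x) 0"
  have hol: "F has_fps_expansion fps_expansion F 0" if "euler_deriv F G" for F G
    by (rule has_fps_expansion_fps_expansion[of "ball 0 1"]) (use euler_deriv_imp_holomorphic[OF that] in auto)
  have h: "brafman x has_fps_expansion h" unfolding h_def by (rule hol[OF euler_brafman[OF x]])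
  have t: "brafman_prod x has_fps_expansion t" unfolding t_def by (rule hol[OF euler_brafman_prod[OF x]])
  have w: "brafman_diff x has_fps_expansion w" unfolding w_def by (rule hol[OF euler_brafman_diff[OF x]])
  have h1: "brafman_theta1 x has_fps_expansion fps_XD h"
    by (rule euler_deriv_imp_has_fps_expansion[OF euler_brafman[OF x] h])
  have h2: "brafman_theta2 x has_fps_expansion fps_XD (fps_XD h)"
    by (rule euler_deriv_imp_has_fps_expansion[OF euler_brafman_theta1[OF x] h1])
  \<comment> \<open>Coefficient form of the definition of \<open>brafman_theta2\<close> with the
    discriminant multiplied out. The conditionals are the zero coefficients created by factors z and
    z^2, where subtraction of naturals would truncate.\<close>
  have E1: "2 * fps_nth t n = of_nat n ^ 2 * fps_nth h n - 2 * ?X * (if n = 0 then 0 else of_nat (n - 1) ^ 2 * fps_nth h (n - 1))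
      + (if n \<le> 1 then 0 else of_nat (n - 2) ^ 2 * fps_nth h (n - 2))
      - ?X * (if n = 0 then 0 else of_nat (n - 1) * fps_nth h (n - 1)) + (if n \<le> 1 then 0 else of_nat (n - 2) * fps_nth h (n - 2))
      - ?X / 4 * (if n = 0 then 0 else fps_nth h (n - 1)) + 1 / 4 * (if n \<le> 1 then 0 else fps_nth h (n - 2))" for n
  proof -
    have l: "(\<lambda>z. 2 * brafman_prod x z) has_fps_expansion fps_const 2 * t"
      by (intro fps_expansion_intros t)
    have r: "(\<lambda>z. brafman_theta2 x z - (2 * ?X) * (z * brafman_theta2 x z) + z * (z * brafman_theta2 x z) - ?X * (z * brafman_theta1 x z) + z * (z * brafman_theta1 x z)
        - (?X / 4) * (z * brafman x z) + (1 / 4) * (z * (z * brafman x z))) has_fps_expansion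
        fps_XD (fps_XD h) - fps_const (2 * ?X) * (fps_X * fps_XD (fps_XD h)) + fps_X * (fps_X * fps_XD (fps_XD h))
        - fps_const ?X * (fps_X * fps_XD h) + fps_X * (fps_X * fps_XD h) - fps_const (?X / 4) * (fps_X * h)
        + fps_const (1 / 4) * (fps_X * (fps_X * h))" (is "?f has_fps_expansion ?F")
      by (intro fps_expansion_intros h h1 h2)
    have ev: "eventually (\<lambda>z. 2 * brafman_prod x z = ?f z) (nhds 0)"
    proof -
      have "eventually (\<lambda>z. z \<in> ball 0 1) (nhds (0 :: complex))"
        by (intro eventually_nhds_in_open) auto
      then show ?thesis
      proof eventually_elim
        case (elim z)
        then have "1 - 2 * ?X * z + z\<^sup>2 \<noteq> 0" using discriminant_nonzero[OF x, of z] by simp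
        then have "(1 - 2 * ?X * z + z\<^sup>2) * brafman_theta2 x z = 2 * brafman_prod x z + z * (?X - z) * (brafman_theta1 x z + brafman x z / 4)"
          by (simp add: brafman_theta2_def)
        then show ?case by (simp add: power2_eq_square field_simps)
      qed
    qed
    have "?f has_fps_expansion fps_const 2 * t"
      using has_fps_expansion_cong[OF ev refl, of "fps_const 2 * t"] l by simp
    from fps_expansion_unique_complex[OF this r]
    have "fps_nth (fps_const 2 * t) n = fps_nth ?F n" by simp
    then show ?thesis
      by (simp add: fps_XD_nth power2_eq_square diff_diff_eq numeral_2_eq_2)
  qed
  have E2: "of_nat n * fps_nth t n = (if n = 0 then 0 else ?X * of_nat (n - 1) * fps_nth h (n - 1) / 8)
       - (if n \<le> 1 then 0 else of_nat (n - 2) * fps_nth h (n - 2) / 8) - (if n = 0 then 0 else fps_nth w (n - 1) / 8)" for n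
  proof -
    have "(\<lambda>z. (?X / 8) * (z * brafman_theta1 x z) - (1 / 8) * (z * (z * brafman_theta1 x z)) - (1 / 8) * (z * brafman_diff x z)) has_fps_expansion
       fps_const (?X / 8) * (fps_X * fps_XD h) - fps_const (1 / 8) * (fps_X * (fps_X * fps_XD h)) - fps_const (1 / 8) * (fps_X * w)"
      (is "_ has_fps_expansion ?F")
      by (intro fps_expansion_intros h1 w)
    also have "(\<lambda>z. (?X / 8) * (z * brafman_theta1 x z) - (1 / 8) * (z * (z * brafman_theta1 x z)) - (1 / 8) * (z * brafman_diff x z)) =
       (\<lambda>z. z * (?X - z) / 8 * brafman_theta1 x z - z * brafman_diff x z / 8)"
      by (simp add: field_simps)
    finally have "fps_XD t = ?F"
      using euler_deriv_imp_has_fps_expansion[OF euler_brafman_prod[OF x] t] fps_expansion_unique_complex by blast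
    then have "fps_nth (fps_XD t) n = fps_nth ?F n" by simp
    then show ?thesis
      by (simp add: fps_XD_nth diff_diff_eq numeral_2_eq_2)
  qed
  have E3: "of_nat n * fps_nth w n = (if n = 0 then 0 else fps_nth h (n - 1) / 4)" for n
  proof -
    have "(\<lambda>z. (1 / 4) * (z * brafman x z)) has_fps_expansion fps_const (1 / 4) * (fps_X * h)"
      by (intro fps_expansion_intros h)
    then have "(\<lambda>z. z * brafman x z / 4) has_fps_expansion fps_const (1 / 4) * (fps_X * h)"
      by simp
    then have "fps_XD w = fps_const (1 / 4) * (fps_X * h)"
      using euler_deriv_imp_has_fps_expansion[OF euler_brafman_diff[OF x] w] fps_expansion_unique_complex by blast
    then have "fps_nth (fps_XD w) n = fps_nth (fps_const (1 / 4) * (fps_X * h)) n" by simp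
    then show ?thesis by (simp add: fps_XD_nth)
  qed
  have at0: "rho x 0 = 1" "alpha x 0 = 0" "beta x 0 = 0"
    by (simp_all add: rho_def alpha_def beta_def)
  have h0: "fps_nth h 0 = 1"
    using has_fps_expansion_imp_0_eq_fps_nth_0[OF h] by (simp add: brafman_def ell_alpha_def ell_beta_def at0)
  have w0: "fps_nth w 0 = 0"
    using has_fps_expansion_imp_0_eq_fps_nth_0[OF w] by (simp add: brafman_diff_def ell_alpha_def ell_beta_def ell_alpha1_def ell_beta1_def at0)
  \<comment> \<open>The recurrence starts to determine coefficients at index 2 only. At index 1,
    \<open>E2\<close> gives a vanishing coefficient of \<open>t\<close>, and \<open>E1\<close> then
    yields this value.\<close>
  have h1': "fps_nth h 1 = ?X / 4"
    using E1[of 1] E2[of 1] w0 h0 by simp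
  have rec: "8 * (of_nat m + 1) * (of_nat m + 2) ^ 3 * fps_nth h (Suc (Suc m)) =
     2 * (of_nat m + 1) * ?X * (2 * of_nat m + 3) ^ 3 * fps_nth h (Suc m)
     - (2 * of_nat m + 1)\<^sup>2 * (2 * of_nat m + 3)\<^sup>2 / 2 * fps_nth h m" for m
  proof -
    define n :: complex where "n = of_nat m"
    have 1: "2 * fps_nth t (Suc (Suc m)) = (n + 2)\<^sup>2 * fps_nth h (Suc (Suc m)) - 2 * ?X * ((n + 1)\<^sup>2 * fps_nth h (Suc m))
      + n\<^sup>2 * fps_nth h m - ?X * ((n + 1) * fps_nth h (Suc m)) + n * fps_nth h m - ?X / 4 * fps_nth h (Suc m) + 1 / 4 * fps_nth h m"
      using E1[of "Suc (Suc m)"] by (simp add: n_def add.commute)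
    have 2: "(n + 2) * fps_nth t (Suc (Suc m)) = ?X * (n + 1) * fps_nth h (Suc m) / 8 - n * fps_nth h m / 8 - fps_nth w (Suc m) / 8"
      using E2[of "Suc (Suc m)"] by (simp add: n_def add.commute)
    have 3: "(n + 1) * fps_nth w (Suc m) = fps_nth h m / 4"
      using E3[of "Suc m"] by (simp add: n_def add.commute)
    \<comment> \<open>The multiplier 8(n + 1)(n + 2) is what \<open>2\<close> and \<open>3\<close>
      need in order to eliminate the coefficients of \<open>t\<close> and \<open>w\<close> without
      division.\<close>
    have "8 * (n + 1) * (n + 2) * (2 * fps_nth t (Suc (Suc m))) =
       2 * ?X * (n + 1)\<^sup>2 * fps_nth h (Suc m) - 2 * n * (n + 1) * fps_nth h m - 2 * ((n + 1) * fps_nth w (Suc m))"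
    proof -
      have "8 * (n + 1) * (n + 2) * (2 * fps_nth t (Suc (Suc m))) = 16 * (n + 1) * ((n + 2) * fps_nth t (Suc (Suc m)))"
        by (simp add: algebra_simps)
      also have "\<dots> = 2 * ?X * (n + 1)\<^sup>2 * fps_nth h (Suc m) - 2 * n * (n + 1) * fps_nth h m - 2 * ((n + 1) * fps_nth w (Suc m))"
        unfolding 2 by (simp add: power2_eq_square algebra_simps)
      finally show ?thesis .
    qed
    then have eq: "8 * (n + 1) * (n + 2) * (2 * fps_nth t (Suc (Suc m))) -
       (2 * ?X * (n + 1)\<^sup>2 * fps_nth h (Suc m) - 2 * n * (n + 1) * fps_nth h m - 2 * ((n + 1) * fps_nth w (Suc m))) = 0"
      by simp
    have "8 * (n + 1) * (n + 2) ^ 3 * fps_nth h (Suc (Suc m)) - (2 * (n + 1) * ?X * (2 * n + 3) ^ 3 * fps_nth h (Suc m)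
     - (2 * n + 1)\<^sup>2 * (2 * n + 3)\<^sup>2 / 2 * fps_nth h m) = 0"
      unfolding eq[symmetric] 1 3 by (simp add: power2_eq_square power3_eq_cube field_simps)
    then show ?thesis
      unfolding n_def[symmetric] by simp
  qed
  have "fps_nth h n = of_real (ell_coeff n * legendre_P n x)" for n
  proof (induction n rule: less_induct)
    case (less n)
    show ?case
    proof (cases "n \<le> 1")
      case True
      then consider "n = 0" | "n = 1" by linarith
      then show ?thesis
        using h0 h1' by cases (auto simp: ell_coeff_Suc power2_eq_square)
    next
      case False
      then have "n = Suc (Suc (n - 2))" by simp
      then obtain m where n: "n = Suc (Suc m)" by blast
      define u where "u = (\<lambda>n. ell_coeff n * legendre_P n x)"
      have IH: "fps_nth h (Suc m) = of_real (u (Suc m))" "fps_nth h m = of_real (u m)"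
        using less[of "Suc m"] less[of m] by (auto simp: n u_def)
      have r: "8 * (real m + 1) * (real m + 2) ^ 3 * u (Suc (Suc m)) =
        2 * (real m + 1) * x * (2 * real m + 3) ^ 3 * u (Suc m)
        - (2 * real m + 1)\<^sup>2 * (2 * real m + 3)\<^sup>2 / 2 * u m"
        unfolding u_def by (rule brafman_coeff_rec)
      have "of_real (8 * (real m + 1) * (real m + 2) ^ 3) * fps_nth h (Suc (Suc m)) =
         of_real (8 * (real m + 1) * (real m + 2) ^ 3) * (of_real (u (Suc (Suc m))) :: complex)"
        unfolding of_real_mult[symmetric] r using rec[of m] by (simp add: IH)
      moreover have "8 * (real m + 1) * (real m + 2) ^ 3 \<noteq> 0"
        using of_nat_0_le_iff[of m, where 'a=real] by (simp del: of_nat_0_le_iff)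
      ultimately show ?thesis
        by (simp only: mult_cancel_left of_real_eq_0_iff n u_def) auto
    qed
  qed
  then have "h = Abs_fps (\<lambda>n. of_real (ell_coeff n * legendre_P n x))"
    by (simp add: fps_eq_iff)
  then show ?thesis using h by simp
qed

text \<open>Holomorphy on the whole unit disc makes the Taylor series converge there to the
  function, and each Euler derivative contributes a factor n.\<close>

lemma brafman_sums:
  assumes z: "norm z < 1"
  shows "(\<lambda>n. of_real (ell_coeff n * legendre_P n x) * z ^ n) sums brafman x z"
    and "(\<lambda>n. of_nat n * of_real (ell_coeff n * legendre_P n x) * z ^ n) sums brafman_theta1 x z"
    and "(\<lambda>n. of_nat n ^ 2 * of_real (ell_coeff n * legendre_P n x) * z ^ n) sums brafman_theta2 x z"
    and "(\<lambda>n. of_nat n ^ 3 * of_real (ell_coeff n * legendre_P n x) * z ^ n) sums brafman_theta3 x z"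
proof -
  note e = euler_deriv_imp_has_fps_expansion
  have s: "(\<lambda>n. fps_nth a n * z ^ n) sums F z" if "F has_fps_expansion a" "F holomorphic_on ball 0 1" for F a
    using has_fps_expansion_imp_sums_complex[OF that(1), of "ereal 1" z] that(2) z by simp
  note 0 = brafman_expansion
  note 1 = e[OF euler_brafman[OF x] 0]
  note 2 = e[OF euler_brafman_theta1[OF x] 1]
  note 3 = e[OF euler_brafman_theta2[OF x] 2]
  note h = euler_deriv_imp_holomorphic
  show "(\<lambda>n. of_real (ell_coeff n * legendre_P n x) * z ^ n) sums brafman x z"
    using s[OF 0 h[OF euler_brafman[OF x]]] by simp
  show "(\<lambda>n. of_nat n * of_real (ell_coeff n * legendre_P n x) * z ^ n) sums brafman_theta1 x z"
    using s[OF 1 h[OF euler_brafman_theta1[OF x]]] by (simp add: fps_XD_nth)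
  show "(\<lambda>n. of_nat n ^ 2 * of_real (ell_coeff n * legendre_P n x) * z ^ n) sums brafman_theta2 x z"
    using s[OF 2 h[OF euler_brafman_theta2[OF x]]] by (simp add: fps_XD_nth power2_eq_square mult.assoc)
  show "(\<lambda>n. of_nat n ^ 3 * of_real (ell_coeff n * legendre_P n x) * z ^ n) sums brafman_theta3 x z"
    using s[OF 3 brafman_theta3_holomorphic[OF x]] by (simp add: fps_XD_nth power3_eq_cube mult.assoc)
qed

end

section \<open>Evaluation at the special point\<close>

text \<open>
  Both sides solve the self-adjoint equation \<open>((1 - k\<^sup>2) y')' = - (1 - k\<^sup>2) / (4 k\<^sup>2) y\<close>. Their Wronskian vanishes at
  the regular singular point \<open>k = 1\<close>, where both sides equal 1.
\<close>

lemma ell_quadratic_transformation: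
  fixes k :: real
  assumes k: "0 < k" "k < 1" and k2: "(1 - k)\<^sup>2 < 4 * k"
  defines "b \<equiv> - ((1 - k)\<^sup>2 / (4 * k))"
  shows "ell b = sqrt k * ell (1 - k\<^sup>2)" (is ?A)
    and "b * (1 - b) * dell b =
           sqrt k * (k * (1 - k\<^sup>2) / 2 * dell (1 - k\<^sup>2) - (1 - k\<^sup>2) / (8 * k) * ell (1 - k\<^sup>2))" (is ?B)
proof -
  define \<beta> where "\<beta> = (\<lambda>v::real. - ((1 - v)\<^sup>2 / (4 * v)))"
  define G where "G = (\<lambda>v. ell (\<beta> v))"
  \<comment> \<open>\<open>G1\<close> is (1 - v^2) G' and \<open>Y1\<close> is (1 - v^2) Y', written
    so that they make sense and can be differentiated at v = 1 too.\<close>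
  define G1 where "G1 = (\<lambda>v. - 4 * (\<beta> v * (1 - \<beta> v) * dell (\<beta> v)))"
  define m where "m = (\<lambda>v::real. ell (1 - v\<^sup>2))"
  define M where "M = (\<lambda>v::real. (1 - v\<^sup>2) * (1 - (1 - v\<^sup>2)) * dell (1 - v\<^sup>2))"
  define Y where "Y = (\<lambda>v. sqrt v * m v)"
  define Y1 where "Y1 = (\<lambda>v. sqrt v * ((1 - v\<^sup>2) * m v / (2 * v) - 2 * M v / v))"
  \<comment> \<open>The argument moves from k to 1; (1 - v)^2 decreases and 4v increases, so the
    hypothesis at k keeps \<open>ell\<close> within its disc all along the interval.\<close>
  have v: "0 < v" "norm (\<beta> v) < 1" "norm (1 - v\<^sup>2) < 1" if "v \<in> {k..1}" for v
  proof -
    show "0 < v" using that k by simp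
    have "(1 - v)\<^sup>2 \<le> (1 - k)\<^sup>2" using that by (intro power_mono) auto
    moreover have "k \<le> v" using that by simp
    ultimately have "(1 - v)\<^sup>2 < 4 * v" using k2 by linarith
    then show "norm (\<beta> v) < 1" using \<open>0 < v\<close> by (simp add: \<beta>_def)
    have "v\<^sup>2 \<le> 1" using that \<open>0 < v\<close> by (intro power_le_one) auto
    then show "norm (1 - v\<^sup>2) < 1" using \<open>0 < v\<close> by simp
  qed
  have dG: "(G has_field_derivative dell (\<beta> v) * ((1 - v\<^sup>2) / (4 * v\<^sup>2))) (at v)"
    and dG1: "(G1 has_field_derivative - ((1 - v\<^sup>2) / (4 * v\<^sup>2) * G v)) (at v)"
    and eG: "(1 - v\<^sup>2) * (dell (\<beta> v) * ((1 - v\<^sup>2) / (4 * v\<^sup>2))) = G1 v" if "v \<in> {k..1}" for v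
  proof -
    note v = v[OF that]
    have d: "(\<beta> has_field_derivative (1 - v\<^sup>2) / (4 * v\<^sup>2)) (at v)"
      unfolding \<beta>_def using v(1)
      by (auto intro!: derivative_eq_intros simp: divide_simps) (simp add: power2_eq_square algebra_simps)
    show "(G has_field_derivative dell (\<beta> v) * ((1 - v\<^sup>2) / (4 * v\<^sup>2))) (at v)"
      unfolding G_def by (rule has_field_derivative_ell_compose[OF d v(2)])
    show "(G1 has_field_derivative - ((1 - v\<^sup>2) / (4 * v\<^sup>2) * G v)) (at v)"
      using DERIV_cmult[OF ell_ode_compose[OF d v(2)], of "-4"] unfolding G1_def G_def
      by (simp add: mult.commute)
    have "\<beta> v * (1 - \<beta> v) = - ((1 - v\<^sup>2)\<^sup>2 / (16 * v\<^sup>2))"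
      using v(1) by (simp add: \<beta>_def divide_simps) (simp add: power2_eq_square algebra_simps)
    then show "(1 - v\<^sup>2) * (dell (\<beta> v) * ((1 - v\<^sup>2) / (4 * v\<^sup>2))) = G1 v"
      unfolding G1_def by (simp add: power2_eq_square)
  qed
  define Y' where "Y' = (\<lambda>v. sqrt v * (m v / (2 * v) - 2 * v * dell (1 - v\<^sup>2)))"
  have dY: "(Y has_field_derivative Y' v) (at v)"
    and dY1: "(Y1 has_field_derivative - ((1 - v\<^sup>2) / (4 * v\<^sup>2) * Y v)) (at v)"
    and eY: "(1 - v\<^sup>2) * Y' v = Y1 v" if "v \<in> {k..1}" for v
  proof -
    note v = v[OF that]
    have d: "((\<lambda>v. 1 - v\<^sup>2) has_field_derivative - 2 * v) (at v)"
      by (auto intro!: derivative_eq_intros)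
    have dm: "(m has_field_derivative dell (1 - v\<^sup>2) * (- 2 * v)) (at v)"
      unfolding m_def by (rule has_field_derivative_ell_compose[OF d v(3)])
    have dM: "(M has_field_derivative m v / 4 * (- 2 * v)) (at v)"
      unfolding M_def m_def by (rule ell_ode_compose[OF d v(3)])
    have sq: "(sqrt has_field_derivative sqrt v / (2 * v)) (at v)"
    proof -
      have "inverse (sqrt v) / 2 = sqrt v / (2 * v)"
        using v(1) by (simp add: field_simps)
      then show ?thesis using DERIV_real_sqrt[OF v(1)] by (simp only:)
    qed
    have d2: "((\<lambda>v. (1 - v\<^sup>2) * m v / (2 * v) - 2 * M v / v) has_field_derivative
       - (1 - v\<^sup>2) / (2 * v\<^sup>2) * m v + (1 - v\<^sup>2) * dell (1 - v\<^sup>2)) (at v)"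
      using v(1)
      by (auto intro!: derivative_eq_intros dm dM) (simp add: M_def field_simps power2_eq_square)
    show "(Y has_field_derivative Y' v) (at v)"
      unfolding Y_def Y'_def using DERIV_mult[OF sq dm] by (simp add: algebra_simps)
    show "(1 - v\<^sup>2) * Y' v = Y1 v"
      unfolding Y1_def Y'_def M_def using v(1) by (simp add: field_simps power2_eq_square)
    have factor: "s / c * A + (- P / Q * y + D) * s = s * (A / c - P / Q * y + D)" for s c A P Q y D :: real
      by (simp add: distrib_left right_diff_distrib distrib_right left_diff_distrib mult.commute mult.left_commute)
    have "sqrt v / (2 * v) * ((1 - v\<^sup>2) * m v / (2 * v) - 2 * M v / v) +
        (- (1 - v\<^sup>2) / (2 * v\<^sup>2) * m v + (1 - v\<^sup>2) * dell (1 - v\<^sup>2)) * sqrt v =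
        sqrt v * (((1 - v\<^sup>2) * m v / (2 * v) - 2 * M v / v) / (2 * v) - (1 - v\<^sup>2) / (2 * v\<^sup>2) * m v + (1 - v\<^sup>2) * dell (1 - v\<^sup>2))"
      by (rule factor)
    also have "((1 - v\<^sup>2) * m v / (2 * v) - 2 * M v / v) / (2 * v) - (1 - v\<^sup>2) / (2 * v\<^sup>2) * m v + (1 - v\<^sup>2) * dell (1 - v\<^sup>2)
       = - ((1 - v\<^sup>2) / (4 * v\<^sup>2) * m v)"
      unfolding M_def using v(1) by (simp add: field_simps power2_eq_square)
    finally show "(Y1 has_field_derivative - ((1 - v\<^sup>2) / (4 * v\<^sup>2) * Y v)) (at v)"
      unfolding Y1_def Y_def using DERIV_mult[OF sq d2] by (simp add: mult.left_commute)
  qed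
  define Wr where "Wr = (\<lambda>v. G v * Y1 v - G1 v * Y v)"
  have dWr: "(Wr has_field_derivative 0) (at v)" if "v \<in> {k..1}" for v
  proof -
    have "(Wr has_field_derivative
      (dell (\<beta> v) * ((1 - v\<^sup>2) / (4 * v\<^sup>2)) * Y1 v + - ((1 - v\<^sup>2) / (4 * v\<^sup>2) * Y v) * G v) -
      (- ((1 - v\<^sup>2) / (4 * v\<^sup>2) * G v) * Y v + Y' v * G1 v)) (at v)"
      unfolding Wr_def
      by (intro DERIV_diff DERIV_mult dG dG1 dY dY1 that)
    also have "(dell (\<beta> v) * ((1 - v\<^sup>2) / (4 * v\<^sup>2)) * Y1 v + - ((1 - v\<^sup>2) / (4 * v\<^sup>2) * Y v) * G v) -
      (- ((1 - v\<^sup>2) / (4 * v\<^sup>2) * G v) * Y v + Y' v * G1 v) = 0"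
      unfolding eG[OF that, symmetric] eY[OF that, symmetric] by (simp add: algebra_simps)
    finally show ?thesis .
  qed
  obtain c where c: "Wr v = c" if "v \<in> {k..1}" for v
    using has_field_derivative_zero_constant[of "{k..1}" Wr] dWr
    by (metis convex_real_interval(5) has_field_derivative_at_within)
  have "Wr 1 = 0"
    by (simp add: Wr_def G1_def Y1_def \<beta>_def M_def)
  then have W0: "Wr v = 0" if "v \<in> {k..1}" for v
    using c[OF that] c[of 1] k by simp
  have Ypos: "Y v > 0" if "v \<in> {k..1}" for v
    unfolding Y_def m_def using v[OF that] that
    by (intro mult_pos_pos ell_pos) (auto simp: abs_square_le_1 power2_eq_square[symmetric])
  have dQ: "((\<lambda>v. G v / Y v) has_field_derivative 0) (at v)" if "v \<in> {k..1}" for v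
  proof -
    let ?g = "dell (\<beta> v) * ((1 - v\<^sup>2) / (4 * v\<^sup>2))"
    \<comment> \<open>Off v = 1 this is the vanishing Wronskian divided by 1 - v^2. At v = 1 that
      division fails, but both derivatives are 0: \<open>Y'\<close> gives 1/2 - 2 * (1/4).\<close>
    have "?g * Y v - G v * Y' v = 0"
    proof (cases "v = 1")
      case True
      then show ?thesis by (simp add: Y'_def m_def)
    next
      case False
      then have "v\<^sup>2 < 1" using that k by (simp add: abs_square_less_1)
      moreover have "(1 - v\<^sup>2) * (?g * Y v - G v * Y' v) = - Wr v"
        unfolding Wr_def eG[OF that, symmetric] eY[OF that, symmetric] by (simp add: algebra_simps)
      ultimately show ?thesis using W0[OF that] by simp
    qed
    then show ?thesis
      using DERIV_divide[OF dG[OF that] dY[OF that]] Ypos[OF that] by simp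
  qed
  obtain c' where c': "G v / Y v = c'" if "v \<in> {k..1}" for v
    using has_field_derivative_zero_constant[of "{k..1}" "\<lambda>v. G v / Y v"] dQ
    by (metis (no_types, lifting) convex_real_interval(5) has_field_derivative_at_within)
  have "G 1 / Y 1 = 1"
    by (simp add: G_def Y_def \<beta>_def m_def)
  then have "G k / Y k = 1"
    using c'[of 1] c'[of k] k by simp
  then have GY: "G k = Y k" using Ypos[of k] k by simp
  then show ?A by (simp add: G_def Y_def b_def \<beta>_def m_def)
  have "Y k * (Y1 k - G1 k) = 0"
    using W0[of k] k GY by (simp add: Wr_def algebra_simps)
  then have "G1 k = Y1 k" using Ypos[of k] k by simp
  then have "b * (1 - b) * dell b = - Y1 k / 4"
    by (simp add: G1_def b_def \<beta>_def)
  also have "\<dots> = sqrt k * (k * (1 - k\<^sup>2) / 2 * dell (1 - k\<^sup>2) - (1 - k\<^sup>2) / (8 * k) * ell (1 - k\<^sup>2))"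
    unfolding Y1_def M_def m_def using k by (simp add: field_simps power2_eq_square)
  finally show ?B .
qed

text \<open>
  The coefficients are such that the second derivative \<open>h2\<close> and the product \<open>f1 g1\<close> cancel, which leaves
  the combination occurring in Legendre's relation.
\<close>

lemma C_combination:
  fixes k x z r f f1 g g1 :: real
  assumes k: "0 < k" "k < 1"
    and x: "x * (4 * k\<^sup>2 - 3 * k + 1) = 1 - 3 * k + 2 * k\<^sup>2 - 2 * k ^ 3"
    and z: "z = - (1 + k) * (4 * k\<^sup>2 - 3 * k + 1) / (4 * k)"
    and r: "r = (1 - k) * (4 * k\<^sup>2 + 3 * k + 1) / (4 * k)"
    and h1: "h1 = (f1 * g + f * g1) / r"
    and h3: "h3 = (3 * z * (x - z) * h2 + z * (x - 2 * z) * (h1 + f * g / 4)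
                + z * (x - z) / 2 * h1 - z * (f * g1 - f1 * g) / 4) / r\<^sup>2"
  shows "C3 k * h3 + C2 k * h2 + C1 k * h1 + C0 k * (f * g) =
    8 * k * (4 * k\<^sup>2 - 3 * k + 1) * (f * (2 * k * g1 + (1 - k\<^sup>2) / 4 * g) + f1 * g)"
proof -
  define p where "p = 4 * k\<^sup>2 - 3 * k + 1"
  define q where "q = 4 * k\<^sup>2 + 3 * k + 1"
  \<comment> \<open>\<kappa> is \<open>C3 k\<close> divided by r^2, so multiplying \<open>h3\<close>
    by \<open>C3 k\<close> removes its denominator. The denominators k and k + 1 also cancel in
    \<kappa>z, \<kappa>zx and \<kappa>z^2, which are polynomials in k.\<close>
  define \<kappa> where "\<kappa> = 64 * k\<^sup>2 * (2 * k - 1) / (k + 1)"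
  have q: "q > 0" using k by (simp add: q_def add_pos_pos)
  have r0: "r > 0" using k q by (simp add: r q_def[symmetric])
  have \<kappa>k: "\<kappa> * (k + 1) = 64 * k\<^sup>2 * (2 * k - 1)"
    using k by (simp add: \<kappa>_def)
  have z4: "4 * k * z = - (1 + k) * p"
    using k by (simp add: z p_def)
  have \<kappa>z: "\<kappa> * z = - 16 * k * (2 * k - 1) * p"
  proof -
    have "\<kappa> * z * (k + 1) = - 16 * k * (2 * k - 1) * p * (k + 1)"
      using z4 \<kappa>k by algebra
    then show ?thesis using k by (subst (asm) mult_right_cancel) auto
  qed
  have \<kappa>zx: "\<kappa> * (z * x) = - 16 * k * (2 * k - 1) * (1 - 3 * k + 2 * k\<^sup>2 - 2 * k ^ 3)"
  proof -
    have "\<kappa> * (z * x) = (\<kappa> * z) * x" by simp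
    also have "\<dots> = - 16 * k * (2 * k - 1) * (x * p)" unfolding \<kappa>z by simp
    finally show ?thesis unfolding p_def x .
  qed
  have \<kappa>zz: "\<kappa> * (z * z) = 4 * (2 * k - 1) * (1 + k) * p\<^sup>2"
  proof -
    have "\<kappa> * (z * z) = (\<kappa> * z) * z" by simp
    also have "\<dots> = 4 * (2 * k - 1) * (1 + k) * p\<^sup>2"
      unfolding \<kappa>z using z4 by algebra
    finally show ?thesis .
  qed
  have C3: "C3 k = \<kappa> * r\<^sup>2"
  proof -
    have "C3 k * (k + 1) = 4 * (k - 1)\<^sup>2 * (2 * k - 1) * q\<^sup>2"
      unfolding C3_def q_def using k by simp
    moreover have "4 * k * r = (1 - k) * q"
      using k by (simp add: r q_def)
    ultimately have "C3 k * (k + 1) = \<kappa> * r\<^sup>2 * (k + 1)"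
      using \<kappa>k by algebra
    then show ?thesis using k by (subst (asm) mult_right_cancel) auto
  qed
  have C2: "3 * (\<kappa> * (z * x) - \<kappa> * (z * z)) = - C2 k"
    unfolding \<kappa>zx \<kappa>zz C2_def p_def by (simp add: power2_eq_square power3_eq_cube power4_eq_xxxx algebra_simps)
  \<comment> \<open>The factor (1 - k)q equals 4kr and so cancels the denominator of
    \<open>h1\<close>.\<close>
  have C1: "C1 k + 3 / 2 * (\<kappa> * (z * x)) - 5 / 2 * (\<kappa> * (z * z)) = (1 - k) * q * (2 * k + 1) * p"
    unfolding \<kappa>zx \<kappa>zz C1_def p_def q_def by (simp add: eval_nat_numeral field_simps)
  have C0: "C0 k + (\<kappa> * (z * x)) / 4 - (\<kappa> * (z * z)) / 2 = 2 * k * (1 - k\<^sup>2) * p"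
    unfolding \<kappa>zx \<kappa>zz C0_def p_def by (simp add: eval_nat_numeral field_simps)
  have "C3 k * h3 = \<kappa> * (3 * z * (x - z) * h2 + z * (x - 2 * z) * (h1 + f * g / 4)
                + z * (x - z) / 2 * h1 - z * (f * g1 - f1 * g) / 4)"
    unfolding C3 h3 using r0 by simp
  also have "\<dots> = 3 * (\<kappa> * (z * x) - \<kappa> * (z * z)) * h2 + (3 / 2 * (\<kappa> * (z * x)) - 5 / 2 * (\<kappa> * (z * z))) * h1
      + ((\<kappa> * (z * x)) / 4 - (\<kappa> * (z * z)) / 2) * (f * g) - \<kappa> * z * (f * g1 - f1 * g) / 4"
    by (simp add: field_simps)
  finally have "C3 k * h3 + C2 k * h2 + C1 k * h1 + C0 k * (f * g) =
      (C1 k + 3 / 2 * (\<kappa> * (z * x)) - 5 / 2 * (\<kappa> * (z * z))) * h1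
      + (C0 k + (\<kappa> * (z * x)) / 4 - (\<kappa> * (z * z)) / 2) * (f * g) - \<kappa> * z * (f * g1 - f1 * g) / 4"
    unfolding C2 by (simp add: algebra_simps)
  also have "\<dots> = (2 * k + 1) * p * ((1 - k) * q * h1) + 2 * k * (1 - k\<^sup>2) * p * (f * g)
      + 4 * k * (2 * k - 1) * p * (f * g1 - f1 * g)"
    unfolding C1 C0 \<kappa>z by (simp add: field_simps)
  also have "(1 - k) * q * h1 = 4 * k * (f1 * g + f * g1)"
    unfolding h1 r q_def[symmetric] using k q by simp
  also have "(2 * k + 1) * p * (4 * k * (f1 * g + f * g1)) + 2 * k * (1 - k\<^sup>2) * p * (f * g)
      + 4 * k * (2 * k - 1) * p * (f * g1 - f1 * g) =
      8 * k * p * (f * (2 * k * g1 + (1 - k\<^sup>2) / 4 * g) + f1 * g)"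
    by (simp add: field_simps power2_eq_square)
  finally show ?thesis unfolding p_def .
qed

section \<open>The series at the special point\<close>

theorem theorem2:
  fixes k :: real
  assumes "k \<in> {(sqrt 41 - 5) / 8 <..< 1}"
  shows "(\<lambda>n::nat. (real ((2 * n) choose n))\<^sup>2
            * legendre_P n ((1 - 3 * k + 2 * k\<^sup>2 - 2 * k ^ 3) / (4 * k\<^sup>2 - 3 * k + 1))
            * (- (1 + k) * (4 * k\<^sup>2 - 3 * k + 1) / (64 * k)) ^ n
            * (C3 k * real n ^ 3 + C2 k * (real n)\<^sup>2 + C1 k * real n + C0 k))
         sums (8 * k powr (3 / 2) * (4 * k\<^sup>2 - 3 * k + 1) / pi)"
proof -
  define p where "p = 4 * k\<^sup>2 - 3 * k + 1"
  define x where "x = (1 - 3 * k + 2 * k\<^sup>2 - 2 * k ^ 3) / p"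
  define z where "z = - (1 + k) * p / (4 * k)"
  define r where "r = (1 - k) * (4 * k\<^sup>2 + 3 * k + 1) / (4 * k)"
  define b where "b = - ((1 - k)\<^sup>2 / (4 * k))"
  \<comment> \<open>The rational bound 32/5 gives k > 7/40, just above 3 - 2 sqrt 2, where (1 - k)^2
    = 4k.\<close>
  have s41: "sqrt 41 > 32 / 5"
    by (rule real_less_rsqrt) (simp add: power2_eq_square)
  have k: "7 / 40 < k" "k < 1"
    using assms s41 by (auto simp: field_simps)
  have k0: "0 < k" using k by simp
  have p: "p > 0"
  proof -
    have "p = (2 * k - 3 / 4)\<^sup>2 + 7 / 16" by (simp add: p_def power2_eq_square field_simps)
    then show ?thesis by (simp add: add_nonneg_pos)
  qed
  \<comment> \<open>The left endpoint (sqrt 41 - 5)/8 is the positive root of this quadratic. Its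
    positivity is what makes |z| < 1 below.\<close>
  have quad: "4 * k\<^sup>2 + 5 * k - 1 > 0"
  proof -
    have "(sqrt 41)\<^sup>2 < (8 * k + 5)\<^sup>2"
      using assms by (intro power_strict_mono) (auto simp: field_simps)
    then show ?thesis by (simp add: power2_eq_square algebra_simps)
  qed
  have k4: "(1 - k)\<^sup>2 < 4 * k"
  proof -
    have "(k - 7 / 40) * (k - 1) < 0" using k by (simp add: mult_less_0_iff)
    also have "(k - 7 / 40) * (k - 1) = k\<^sup>2 - 47 / 40 * k + 7 / 40"
      by (simp add: power2_eq_square field_simps)
    finally have "1 - 2 * k + k\<^sup>2 < 4 * k" using k by linarith
    then show ?thesis by (simp add: power2_diff)
  qed
  have x1: "\<bar>x\<bar> < 1"
  proof -
    have "p - (1 - 3 * k + 2 * k\<^sup>2 - 2 * k ^ 3) = 2 * k\<^sup>2 * (1 + k)"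
      by (simp add: p_def power2_eq_square power3_eq_cube algebra_simps)
    moreover have "p + (1 - 3 * k + 2 * k\<^sup>2 - 2 * k ^ 3) = 2 * (1 - k) ^ 3"
      by (simp add: p_def power2_eq_square power3_eq_cube algebra_simps)
    moreover have "2 * k\<^sup>2 * (1 + k) > 0" "2 * (1 - k) ^ 3 > 0" using k by simp_all
    ultimately have "\<bar>1 - 3 * k + 2 * k\<^sup>2 - 2 * k ^ 3\<bar> < p" by linarith
    then show ?thesis using p by (simp add: x_def)
  qed
  have z1: "\<bar>z\<bar> < 1"
  proof -
    have "4 * k - (1 + k) * p = (1 - k) * (4 * k\<^sup>2 + 5 * k - 1)"
      by (simp add: p_def power2_eq_square algebra_simps)
    then have "4 * k - (1 + k) * p > 0" using quad k by simp
    then show ?thesis using k p by (simp add: z_def abs_mult add.commute)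
  qed
  have px: "x * p = 1 - 3 * k + 2 * k\<^sup>2 - 2 * k ^ 3" using p by (simp add: x_def)
  have r0: "r > 0" using k by (simp add: r_def add_pos_pos)
  have zx: "z * x = - (1 + k) * (1 - 3 * k + 2 * k\<^sup>2 - 2 * k ^ 3) / (4 * k)"
    unfolding z_def px[symmetric] by simp
  have R: "1 - 2 * x * z + z\<^sup>2 = r\<^sup>2"
  proof -
    have "1 - 2 * x * z + z\<^sup>2 = 1 - 2 * (z * x) + z\<^sup>2" by simp
    also have "\<dots> = r\<^sup>2"
      unfolding zx unfolding z_def r_def p_def using k0
      by (simp add: power2_eq_square power3_eq_cube divide_simps) (simp add: algebra_simps)
    finally show ?thesis .
  qed
  have al: "(1 - r - z) / 2 = k\<^sup>2"
    unfolding z_def r_def p_def using k0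
    by (simp add: divide_simps) (simp add: power2_eq_square algebra_simps)
  have be: "(1 - r + z) / 2 = b"
    unfolding z_def r_def p_def b_def using k0
    by (simp add: divide_simps) (simp add: power2_eq_square algebra_simps)
  have k21: "norm (k\<^sup>2) < 1" using k by (simp add: abs_square_less_1)
  have b1: "norm b < 1" using k4 k0 by (simp add: b_def)
  define f where "f = ell (k\<^sup>2)"
  define f1 where "f1 = k\<^sup>2 * (1 - k\<^sup>2) * dell (k\<^sup>2)"
  define g where "g = ell b"
  define g1 where "g1 = b * (1 - b) * dell b"
  define h1 where "h1 = (f1 * g + f * g1) / r"
  define h2 where "h2 = (2 * (f1 * g1) + z * (x - z) * (h1 + f * g / 4)) / r\<^sup>2"
  define h3 where "h3 = (3 * z * (x - z) * h2 + z * (x - 2 * z) * (h1 + f * g / 4)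
                + z * (x - z) / 2 * h1 - z * (f * g1 - f1 * g) / 4) / r\<^sup>2"
  let ?z = "complex_of_real z"
  have Rc: "1 - 2 * of_real x * ?z + ?z\<^sup>2 = of_real (r\<^sup>2)"
    unfolding R[symmetric] by simp
  \<comment> \<open>Positivity of \<open>r\<close> selects the principal square root, so
    \<open>alpha\<close> and \<open>beta\<close> become k^2 and b.\<close>
  have rc: "rho x ?z = of_real r"
    unfolding rho_def Rc using csqrt_square[of "of_real r"] r0 by simp
  have ac: "alpha x ?z = of_real (k\<^sup>2)" unfolding alpha_def rc al[symmetric] by simp
  have bc: "beta x ?z = of_real b" unfolding beta_def rc be[symmetric] by simp
  have F: "ell_alpha x ?z = of_real f" "ell_alpha1 x ?z = of_real f1"
    using ell_of_real[OF k21, where 'a=complex] dell_of_real[OF k21, where 'a=complex]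
    unfolding ell_alpha_def ell_alpha1_def ac f_def f1_def by simp_all
  have Gc: "ell_beta x ?z = of_real g" "ell_beta1 x ?z = of_real g1"
    using ell_of_real[OF b1, where 'a=complex] dell_of_real[OF b1, where 'a=complex]
    unfolding ell_beta_def ell_beta1_def bc g_def g1_def by simp_all
  have H0: "brafman x ?z = of_real (f * g)" by (simp add: brafman_def F Gc)
  have H1: "brafman_theta1 x ?z = of_real h1" by (simp add: brafman_theta1_def brafman_sum_def F Gc rc h1_def)
  have H2: "brafman_theta2 x ?z = of_real h2" unfolding brafman_theta2_def Rc H0 H1 by (simp add: brafman_prod_def F Gc h2_def)
  have H3: "brafman_theta3 x ?z = of_real h3" unfolding brafman_theta3_def Rc H0 H1 H2 by (simp add: brafman_diff_def F Gc h3_def)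
  define u where "u = (\<lambda>n. ell_coeff n * legendre_P n x * z ^ n)"
  have zc: "norm ?z < 1" using z1 by simp
  note S = brafman_sums[OF x1 zc, unfolded H0 H1 H2 H3]
  have S0: "u sums (f * g)"
    using S(1) unfolding u_def by (subst sums_of_real_iff[symmetric, where 'a=complex]) simp
  have S1: "(\<lambda>n. real n * u n) sums h1"
    using S(2) unfolding u_def by (subst sums_of_real_iff[symmetric, where 'a=complex]) (simp add: mult.assoc)
  have S2: "(\<lambda>n. real n ^ 2 * u n) sums h2"
    using S(3) unfolding u_def by (subst sums_of_real_iff[symmetric, where 'a=complex]) (simp add: mult.assoc)
  have S3: "(\<lambda>n. real n ^ 3 * u n) sums h3"
    using S(4) unfolding u_def by (subst sums_of_real_iff[symmetric, where 'a=complex]) (simp add: mult.assoc)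
  have "(\<lambda>n. C3 k * (real n ^ 3 * u n) + C2 k * (real n ^ 2 * u n) + C1 k * (real n * u n) + C0 k * u n)
     sums (C3 k * h3 + C2 k * h2 + C1 k * h1 + C0 k * (f * g))"
    by (intro sums_add sums_mult S0 S1 S2 S3)
  also have "C3 k * h3 + C2 k * h2 + C1 k * h1 + C0 k * (f * g) =
    8 * k * (4 * k\<^sup>2 - 3 * k + 1) * (f * (2 * k * g1 + (1 - k\<^sup>2) / 4 * g) + f1 * g)"
    by (rule C_combination[OF k0 k(2) px[unfolded p_def] z_def[unfolded p_def] r_def h1_def h3_def])
  also have "f * (2 * k * g1 + (1 - k\<^sup>2) / 4 * g) + f1 * g =
      sqrt k * (ell (k\<^sup>2) * (k\<^sup>2 * (1 - k\<^sup>2) * dell (1 - k\<^sup>2)) + k\<^sup>2 * (1 - k\<^sup>2) * dell (k\<^sup>2) * ell (1 - k\<^sup>2))"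
  proof -
    \<comment> \<open>The coefficients 2k and (1 - k^2)/4 are such that the
      \<open>ell (1 - k^2)\<close> parts of the transformed \<open>g\<close> and \<open>g1\<close>
      cancel, leaving the derivative alone.\<close>
    have e: "2 * k * g1 + (1 - k\<^sup>2) / 4 * g = sqrt k * (k\<^sup>2 * (1 - k\<^sup>2) * dell (1 - k\<^sup>2))"
      unfolding g_def g1_def b_def ell_quadratic_transformation[OF k0 k(2) k4] using k0
      by (simp add: field_simps power2_eq_square)
    have g: "g = sqrt k * ell (1 - k\<^sup>2)"
      unfolding g_def b_def by (rule ell_quadratic_transformation(1)[OF k0 k(2) k4])
    show ?thesis
      unfolding e unfolding g f_def f1_def by (simp add: algebra_simps)
  qed
  also have "ell (k\<^sup>2) * (k\<^sup>2 * (1 - k\<^sup>2) * dell (1 - k\<^sup>2)) + k\<^sup>2 * (1 - k\<^sup>2) * dell (k\<^sup>2) * ell (1 - k\<^sup>2) = 1 / pi"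
    by (rule legendre_relation) (use k k21 in auto)
  also have "8 * k * (4 * k\<^sup>2 - 3 * k + 1) * (sqrt k * (1 / pi)) = 8 * k powr (3 / 2) * (4 * k\<^sup>2 - 3 * k + 1) / pi"
  proof -
    have "k powr (3 / 2) = k powr 1 * k powr (1 / 2)"
      by (subst powr_add[symmetric]) simp
    then have "k powr (3 / 2) = k * sqrt k" using k0 by (simp add: powr_half_sqrt)
    then show ?thesis by simp
  qed
  also have "(\<lambda>n. C3 k * (real n ^ 3 * u n) + C2 k * (real n ^ 2 * u n) + C1 k * (real n * u n) + C0 k * u n) =
     (\<lambda>n::nat. (real ((2 * n) choose n))\<^sup>2
            * legendre_P n ((1 - 3 * k + 2 * k\<^sup>2 - 2 * k ^ 3) / (4 * k\<^sup>2 - 3 * k + 1))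
            * (- (1 + k) * (4 * k\<^sup>2 - 3 * k + 1) / (64 * k)) ^ n
            * (C3 k * real n ^ 3 + C2 k * (real n)\<^sup>2 + C1 k * real n + C0 k))"
  proof
    fix n
    \<comment> \<open>The squared normalisation in \<open>ell_coeff\<close> accounts for passing
      from z, with denominator 4k, to z/16, with denominator 64k.\<close>
    have "((4 :: real) ^ n)\<^sup>2 = 16 ^ n"
      by (simp add: power2_eq_square flip: power_mult_distrib)
    then have "u n = (real ((2 * n) choose n))\<^sup>2 * legendre_P n x * (z / 16) ^ n"
      by (simp add: u_def ell_coeff_def power_divide)
    also have "z / 16 = - (1 + k) * (4 * k\<^sup>2 - 3 * k + 1) / (64 * k)"
      by (simp add: z_def p_def)
    finally have u: "u n = (real ((2 * n) choose n))\<^sup>2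
            * legendre_P n ((1 - 3 * k + 2 * k\<^sup>2 - 2 * k ^ 3) / (4 * k\<^sup>2 - 3 * k + 1))
            * (- (1 + k) * (4 * k\<^sup>2 - 3 * k + 1) / (64 * k)) ^ n"
      by (simp only: x_def p_def)
    show "C3 k * (real n ^ 3 * u n) + C2 k * (real n ^ 2 * u n) + C1 k * (real n * u n) + C0 k * u n =
       (real ((2 * n) choose n))\<^sup>2
            * legendre_P n ((1 - 3 * k + 2 * k\<^sup>2 - 2 * k ^ 3) / (4 * k\<^sup>2 - 3 * k + 1))
            * (- (1 + k) * (4 * k\<^sup>2 - 3 * k + 1) / (64 * k)) ^ n
            * (C3 k * real n ^ 3 + C2 k * (real n)\<^sup>2 + C1 k * real n + C0 k)"
      unfolding u[symmetric] by (simp add: algebra_simps)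
  qed
  finally show ?thesis .
qed

end
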